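(* Let $M$ be a simple typed term. If $M$ has a head redex, then $M\in SN$ if and only if $arg(M)\subseteq SN$ and $hred(M)\in SN$. Otherwise, $M\in SN$ if and only if $arg(M)\subseteq SN$.
   Context: Formulas: atoms, $\perp$, $\rightarrow,\wedge,\vee$; $\neg A=A\rightarrow\perp$. Intuitionistic variables $x,y,\dots$, classical variables $a,b,\dots$. Terms: ${\cal T} ::= x \mid \lambda x\, {\cal T} \mid ({\cal T}\ {\cal E}) \mid \langle {\cal T},{\cal T}\rangle \mid \omega_1 {\cal T} \mid \omega_2 {\cal T} \mid \mu a\, {\cal T} \mid (a\ {\cal T})$, ${\cal E} ::= {\cal T} \mid \pi_1 \mid \pi_2 \mid [x.{\cal T}, y.{\cal T}]$; $(M\ N_1\dots N_n)=((M\ N_1)\dots N_n)$. Typing (contexts contain $x:A$, $a:\neg A$): $x:A$ for declared $x$; $\langle M,N\rangle:A\wedge B$ from $M:A,N:B$; $(M\ \pi_i):A_i$ from $M:A_1\wedge A_2$; $\lambda xM:A\rightarrow B$ from $M:B$ under $x:A$; $(M\ N):B$ from $M:A\rightarrow B,N:A$; $\omega_iM:A_1\vee A_2$ from $M:A_i$; $(M\ [x_1.N_1,x_2.N_2]):C$ from $M:A_1\vee A_2$ and $N_i:C$ under $x_i:A_i$; $\mu aM:A$ from $M:\perp$ under $a:\neg A$; $(a\ M):\perp$ from $M:A$ under $a:\neg A$. Typed = has a type in some context. Reduction $\triangleright$: compatible closure (including inside branches of $[x.N_1,y.N_2]$) of $(\lambda x M\ N)\triangleright M[x:=N]$; $(\langle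 M_1,M_2\rangle\ \pi_i)\triangleright M_i$; $(\omega_i M\ [x_1.N_1,x_2.N_2])\triangleright N_i[x_i:=M]$; $(M\ [x_1.N_1,x_2.N_2]\ \varepsilon)\triangleright (M\ [x_1.(N_1\ \varepsilon),x_2.(N_2\ \varepsilon)])$; $(\mu a M\ \varepsilon)\triangleright \mu a\, M[a:=^*\varepsilon]$ ($M[a:=^*\varepsilon]$ replaces each subterm $(a\ N)$ by $(a\ (N\ \varepsilon))$). An element of ${\cal E}$ is in $SN$ if it has no infinite reduction sequence (so $[y_1.N_1,y_2.N_2]\in SN$ iff $N_1,N_2\in SN$). A term is simple if it is a variable or an application. A sequence $N_1,\dots,N_n$ of elements of ${\cal E}$ is nice if each $N_i\in{\cal T}\cup\{\pi_1,\pi_2\}$ except possibly $N_n$. Every simple typed term $M$ is uniquely of one of the following forms, with $\overline{T}=T_1,\dots,T_n$ nice and, in (4),(5), $\varepsilon\ \overline{T}$ nice; the head $hd(M)$ and arguments $arg(M)$ are: (0) $M=(x\ \overline{T})$ or $(a\ T)$: $hd(M)=x$ (resp. $a$), $arg(M)=\{T_1,\dots,T_n\}$ (resp. $\{T\}$); (1) $M=(\lambda xN\ O\ \overline{T})$: $hd=(\lambda xN\ O)$, $arg=\{O\}$; (2) $M=(\langle N_1,N_2\rangle\ \pi_i\ \overline{T})$: $hd=(\langle N_1,N_2\rangle\ \pi_i)$, $arg=\{N_1,N_2\}$; (3) $M=(\omega_iN\ [x_1.O_1,x_2.O_2])$: $hd=M$, $arg=\{N,O_1,O_2\}$; (4)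 $M=(\mu aN\ \varepsilon\ \overline{T})$: $hd=(\mu aN\ \varepsilon)$, $arg=\{\varepsilon\}$; (5) $M=(N\ [x_1.O_1,x_2.O_2]\ \varepsilon\ \overline{T})$: $hd=(N\ [x_1.O_1,x_2.O_2]\ \varepsilon)$, $arg=\emptyset$. In cases (1)–(5) $M$ has a head redex, namely $hd(M)$; in case (0) it has none. The head reduct $hred(M)$ is the term obtained from $M$ by reducing its head redex (by the corresponding reduction rule above). *)

theory Defs
  imports Main
begin

datatype fm = Atom nat | Bot | Imp fm fm | And fm fm | Or fm fm

text \<open>
  Terms modulo renaming of bound variables are represented with de Bruijn indices, with two
  independent index spaces: intuitionistic variables are bound by \<open>Lam\<close> and, separately in each
  branch, by \<open>Case\<close>; classical variables are bound by \<open>Mu\<close>.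
  \<open>Case N1 N2\<close> is \<open>[x\<^sub>1.N1, x\<^sub>2.N2]\<close>, \<open>CApp a M\<close> is \<open>(a M)\<close>, and the inclusion of terms
  into the eliminators \<open>elim\<close> (the set \<open>\<E>\<close>) is written \<open>Tm\<close>.
\<close>

datatype trm =
    IVar nat
  | Lam trm
  | App trm elim
  | Pair trm trm
  | Inj1 trm
  | Inj2 trm
  | Mu trm
  | CApp nat trm
and elim =
    Tm trm
  | Proj1
  | Proj2
  | Case trm trm

text \<open>Shifting of the intuitionistic, respectively classical, indices \<open>\<ge> k\<close>.\<close>

primrec lift_i :: "nat \<Rightarrow> trm \<Rightarrow> trm" and lift_i_elim :: "nat \<Rightarrow> elim \<Rightarrow> elim" where
  "lift_i k (IVar i) = IVar (if i < k then i else Suc i)"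
| "lift_i k (Lam M) = Lam (lift_i (Suc k) M)"
| "lift_i k (App M e) = App (lift_i k M) (lift_i_elim k e)"
| "lift_i k (Pair M N) = Pair (lift_i k M) (lift_i k N)"
| "lift_i k (Inj1 M) = Inj1 (lift_i k M)"
| "lift_i k (Inj2 M) = Inj2 (lift_i k M)"
| "lift_i k (Mu M) = Mu (lift_i k M)"
| "lift_i k (CApp a M) = CApp a (lift_i k M)"
| "lift_i_elim k (Tm M) = Tm (lift_i k M)"
| "lift_i_elim k Proj1 = Proj1"
| "lift_i_elim k Proj2 = Proj2"
| "lift_i_elim k (Case M N) = Case (lift_i (Suc k) M) (lift_i (Suc k) N)"

primrec lift_c :: "nat \<Rightarrow> trm \<Rightarrow> trm" and lift_c_elim :: "nat \<Rightarrow> elim \<Rightarrow> elim" where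
  "lift_c k (IVar i) = IVar i"
| "lift_c k (Lam M) = Lam (lift_c k M)"
| "lift_c k (App M e) = App (lift_c k M) (lift_c_elim k e)"
| "lift_c k (Pair M N) = Pair (lift_c k M) (lift_c k N)"
| "lift_c k (Inj1 M) = Inj1 (lift_c k M)"
| "lift_c k (Inj2 M) = Inj2 (lift_c k M)"
| "lift_c k (Mu M) = Mu (lift_c (Suc k) M)"
| "lift_c k (CApp a M) = CApp (if a < k then a else Suc a) (lift_c k M)"
| "lift_c_elim k (Tm M) = Tm (lift_c k M)"
| "lift_c_elim k Proj1 = Proj1"
| "lift_c_elim k Proj2 = Proj2"
| "lift_c_elim k (Case M N) = Case (lift_c k M) (lift_c k N)"

text \<open>\<open>subst k N M\<close> is \<open>M[x := N]\<close> for the variable \<open>x\<close> of index \<open>k\<close>, whose binder disappears.\<close>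

primrec subst :: "nat \<Rightarrow> trm \<Rightarrow> trm \<Rightarrow> trm" and subst_elim :: "nat \<Rightarrow> trm \<Rightarrow> elim \<Rightarrow> elim" where
  "subst k P (IVar i) = (if i < k then IVar i else if i = k then P else IVar (i - 1))"
| "subst k P (Lam M) = Lam (subst (Suc k) (lift_i 0 P) M)"
| "subst k P (App M e) = App (subst k P M) (subst_elim k P e)"
| "subst k P (Pair M N) = Pair (subst k P M) (subst k P N)"
| "subst k P (Inj1 M) = Inj1 (subst k P M)"
| "subst k P (Inj2 M) = Inj2 (subst k P M)"
| "subst k P (Mu M) = Mu (subst k (lift_c 0 P) M)"
| "subst k P (CApp a M) = CApp a (subst k P M)"
| "subst_elim k P (Tm M) = Tm (subst k P M)"
| "subst_elim k P Proj1 = Proj1"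
| "subst_elim k P Proj2 = Proj2"
| "subst_elim k P (Case M N) =
     Case (subst (Suc k) (lift_i 0 P) M) (subst (Suc k) (lift_i 0 P) N)"

text \<open>
  \<open>msubst a e M\<close> is \<open>M[a :=\<^sup>* e]\<close>. The classical variable \<open>a\<close> is kept, so no index is decremented,
  and \<open>e\<close> lives in the same index spaces as \<open>M\<close>.
\<close>

primrec msubst :: "nat \<Rightarrow> elim \<Rightarrow> trm \<Rightarrow> trm" and msubst_elim :: "nat \<Rightarrow> elim \<Rightarrow> elim \<Rightarrow> elim" where
  "msubst a e (IVar i) = IVar i"
| "msubst a e (Lam M) = Lam (msubst a (lift_i_elim 0 e) M)"
| "msubst a e (App M f) = App (msubst a e M) (msubst_elim a e f)"
| "msubst a e (Pair M N) = Pair (msubst a e M) (msubst a e N)"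
| "msubst a e (Inj1 M) = Inj1 (msubst a e M)"
| "msubst a e (Inj2 M) = Inj2 (msubst a e M)"
| "msubst a e (Mu M) = Mu (msubst (Suc a) (lift_c_elim 0 e) M)"
| "msubst a e (CApp b M) =
     (if b = a then CApp b (App (msubst a e M) e) else CApp b (msubst a e M))"
| "msubst_elim a e (Tm M) = Tm (msubst a e M)"
| "msubst_elim a e Proj1 = Proj1"
| "msubst_elim a e Proj2 = Proj2"
| "msubst_elim a e (Case M N) =
     Case (msubst a (lift_i_elim 0 e) M) (msubst a (lift_i_elim 0 e) N)"

text \<open>
  In \<open>typing \<Gamma> \<Delta> M A\<close>, \<open>\<Gamma> ! i\<close> is the type of the intuitionistic variable \<open>i\<close>, and
  \<open>\<Delta> ! a = A\<close> stands for the declaration \<open>a : \<not> A\<close>.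
\<close>

inductive typing :: "fm list \<Rightarrow> fm list \<Rightarrow> trm \<Rightarrow> fm \<Rightarrow> bool" where
  T_IVar: "i < length \<Gamma> \<Longrightarrow> typing \<Gamma> \<Delta> (IVar i) (\<Gamma> ! i)"
| T_Pair: "typing \<Gamma> \<Delta> M A \<Longrightarrow> typing \<Gamma> \<Delta> N B \<Longrightarrow> typing \<Gamma> \<Delta> (Pair M N) (And A B)"
| T_Proj1: "typing \<Gamma> \<Delta> M (And A B) \<Longrightarrow> typing \<Gamma> \<Delta> (App M Proj1) A"
| T_Proj2: "typing \<Gamma> \<Delta> M (And A B) \<Longrightarrow> typing \<Gamma> \<Delta> (App M Proj2) B"
| T_Lam: "typing (A # \<Gamma>) \<Delta> M B \<Longrightarrow> typing \<Gamma> \<Delta> (Lam M) (Imp A B)"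
| T_App: "typing \<Gamma> \<Delta> M (Imp A B) \<Longrightarrow> typing \<Gamma> \<Delta> N A \<Longrightarrow> typing \<Gamma> \<Delta> (App M (Tm N)) B"
| T_Inj1: "typing \<Gamma> \<Delta> M A \<Longrightarrow> typing \<Gamma> \<Delta> (Inj1 M) (Or A B)"
| T_Inj2: "typing \<Gamma> \<Delta> M B \<Longrightarrow> typing \<Gamma> \<Delta> (Inj2 M) (Or A B)"
| T_Case: "typing \<Gamma> \<Delta> M (Or A B) \<Longrightarrow> typing (A # \<Gamma>) \<Delta> N1 C \<Longrightarrow> typing (B # \<Gamma>) \<Delta> N2 C
    \<Longrightarrow> typing \<Gamma> \<Delta> (App M (Case N1 N2)) C"
| T_Mu: "typing \<Gamma> (A # \<Delta>) M Bot \<Longrightarrow> typing \<Gamma> \<Delta> (Mu M) A"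
| T_CApp: "a < length \<Delta> \<Longrightarrow> typing \<Gamma> \<Delta> M (\<Delta> ! a) \<Longrightarrow> typing \<Gamma> \<Delta> (CApp a M) Bot"

definition typed :: "trm \<Rightarrow> bool" where
  "typed M \<longleftrightarrow> (\<exists>\<Gamma> \<Delta> A. typing \<Gamma> \<Delta> M A)"

text \<open>The reduction rules at the root; \<open>red\<close> below is their compatible closure.\<close>

inductive contract :: "trm \<Rightarrow> trm \<Rightarrow> bool" where
  C_Lam: "contract (App (Lam M) (Tm N)) (subst 0 N M)"
| C_Proj1: "contract (App (Pair M1 M2) Proj1) M1"
| C_Proj2: "contract (App (Pair M1 M2) Proj2) M2"
| C_Inj1: "contract (App (Inj1 M) (Case N1 N2)) (subst 0 M N1)"
| C_Inj2: "contract (App (Inj2 M) (Case N1 N2)) (subst 0 M N2)"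
| C_Case: "contract (App (App M (Case N1 N2)) e)
    (App M (Case (App N1 (lift_i_elim 0 e)) (App N2 (lift_i_elim 0 e))))"
| C_Mu: "contract (App (Mu M) e) (Mu (msubst 0 (lift_c_elim 0 e) M))"

inductive red :: "trm \<Rightarrow> trm \<Rightarrow> bool" and red_elim :: "elim \<Rightarrow> elim \<Rightarrow> bool" where
  "contract M M' \<Longrightarrow> red M M'"
| "red M M' \<Longrightarrow> red (Lam M) (Lam M')"
| "red M M' \<Longrightarrow> red (App M e) (App M' e)"
| "red_elim e e' \<Longrightarrow> red (App M e) (App M e')"
| "red M M' \<Longrightarrow> red (Pair M N) (Pair M' N)"
| "red N N' \<Longrightarrow> red (Pair M N) (Pair M N')"
| "red M M' \<Longrightarrow> red (Inj1 M) (Inj1 M')"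
| "red M M' \<Longrightarrow> red (Inj2 M) (Inj2 M')"
| "red M M' \<Longrightarrow> red (Mu M) (Mu M')"
| "red M M' \<Longrightarrow> red (CApp a M) (CApp a M')"
| "red M M' \<Longrightarrow> red_elim (Tm M) (Tm M')"
| "red M M' \<Longrightarrow> red_elim (Case M N) (Case M' N)"
| "red N N' \<Longrightarrow> red_elim (Case M N) (Case M N')"

definition SN :: "elim set" where
  "SN = {e. \<not> (\<exists>f :: nat \<Rightarrow> elim. f 0 = e \<and> (\<forall>i. red_elim (f i) (f (Suc i))))}"

definition simple :: "trm \<Rightarrow> bool" where
  "simple M \<longleftrightarrow> (\<exists>i. M = IVar i) \<or> (\<exists>N e. M = App N e) \<or> (\<exists>a N. M = CApp a N)"

definition nice :: "elim list \<Rightarrow> bool" where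
  "nice Ts \<longleftrightarrow> (\<forall>e \<in> set (butlast Ts). \<forall>N1 N2. e \<noteq> Case N1 N2)"

abbreviation apps :: "trm \<Rightarrow> elim list \<Rightarrow> trm" where
  "apps \<equiv> foldl App"

datatype head = IVarHead nat | CVarHead nat | Redex trm

text \<open>
  \<open>head_form M h S Ts\<close>: the simple term \<open>M\<close> is in the form with head \<open>h\<close> and set
  of arguments \<open>S\<close>. \<open>Ts\<close> is the sequence of eliminators following the head in \<open>M\<close>; for
  \<open>(a T)\<close>, which is not an \<open>App\<close>, this is by convention \<open>T\<close>. The rules are mutually
  exclusive, so \<open>h\<close>, \<open>S\<close> and \<open>Ts\<close> are determined by \<open>M\<close>, and every simple typed term has such a
  form. An untyped one such as \<open>App (Lam N) Proj1\<close> need not. As a redex determines its contractum,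
  the descriptions in \<open>arg\<close> and \<open>hred\<close> below are proper for simple typed terms.
\<close>

inductive head_form :: "trm \<Rightarrow> head \<Rightarrow> elim set \<Rightarrow> elim list \<Rightarrow> bool" where
  H_IVar: "nice Ts \<Longrightarrow> head_form (apps (IVar i) Ts) (IVarHead i) (set Ts) Ts"
| H_CApp: "head_form (CApp a T) (CVarHead a) {Tm T} [Tm T]"
| H_Lam: "R = App (Lam N) (Tm P) \<Longrightarrow> nice Ts
    \<Longrightarrow> head_form (apps R Ts) (Redex R) {Tm P} Ts"
| H_Pair: "R = App (Pair N1 N2) p \<Longrightarrow> p = Proj1 \<or> p = Proj2 \<Longrightarrow> nice Ts
    \<Longrightarrow> head_form (apps R Ts) (Redex R) {Tm N1, Tm N2} Ts"
| H_Inj: "R = App I (Case O1 O2) \<Longrightarrow> I = Inj1 N \<or> I = Inj2 N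
    \<Longrightarrow> head_form R (Redex R) {Tm N, Tm O1, Tm O2} []"
| H_Mu: "R = App (Mu N) e \<Longrightarrow> nice (e # Ts)
    \<Longrightarrow> head_form (apps R Ts) (Redex R) {e} Ts"
| H_Case: "R = App (App N (Case O1 O2)) e \<Longrightarrow> nice (e # Ts)
    \<Longrightarrow> head_form (apps R Ts) (Redex R) {} Ts"

definition has_head_redex :: "trm \<Rightarrow> bool" where
  "has_head_redex M \<longleftrightarrow> (\<exists>R S Ts. head_form M (Redex R) S Ts)"

definition arg :: "trm \<Rightarrow> elim set" where
  "arg M = (THE S. \<exists>h Ts. head_form M h S Ts)"

definition hred :: "trm \<Rightarrow> trm" where
  "hred M = (THE M'. \<exists>R S Ts R'. head_form M (Redex R) S Ts \<and> contract R R' \<and> M' = apps R' Ts)"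

end

theory Submission
  imports Defs
begin

text \<open>
  Every typed term is strongly normalizing, so both sides of each equivalence hold. Strong
  normalization is proved by reducibility: a type is interpreted by a set of sequences of
  eliminators, and a term is reducible if it is strongly normalizing in front of each of them.
  Permutative conversions are harmless because the sequences for a disjunction are characterized
  only through the terms \<open>(N\<^sub>i[x\<^sub>i := M] T\<^sub>1 \<dots> T\<^sub>n)\<close>, which do not change when
  \<open>T\<^sub>1\<close> is permuted into the branches of \<open>[x\<^sub>1.N\<^sub>1, x\<^sub>2.N\<^sub>2] T\<^sub>1 \<dots> T\<^sub>n\<close>.
\<close>

section \<open>Simultaneous substitution\<close>

text \<open>Besides permutations, \<open>Mu\<close> obstructs an induction on reduction: it absorbs
  the eliminators behind it one at a time, and a new redex remains as long as some are left. The
  remedy has the same shape in both cases, a quantity that such a step leaves unchanged while the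
  sequence gets shorter. For \<open>Mu\<close> the quantity is the body with the entire sequence
  \<open>Ts\<close> substituted at once for the bound variable. The length of the sequence therefore
  enters the lexicographic measures. Substituting whole sequences for classical variables is also
  what dictates the general form of substitution below. Testing a \<open>Case\<close> only through
  its instantiated branches has a second effect: the type of the branches, which need not be a
  subformula of the disjunction, is never mentioned, so the interpretation can be defined by
  recursion on formulas.\<close>

abbreviation up :: "(nat \<Rightarrow> nat) \<Rightarrow> nat \<Rightarrow> nat" where
  "up \<xi> \<equiv> case_nat 0 (\<lambda>i. Suc (\<xi> i))"

primrec ren :: "(nat \<Rightarrow> nat) \<Rightarrow> (nat \<Rightarrow> nat) \<Rightarrow> trm \<Rightarrow> trm"
  and ren_elim :: "(nat \<Rightarrow> nat) \<Rightarrow> (nat \<Rightarrow> nat) \<Rightarrow> elim \<Rightarrow> elim" where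
  "ren \<xi> \<zeta> (IVar i) = IVar (\<xi> i)"
| "ren \<xi> \<zeta> (Lam M) = Lam (ren (up \<xi>) \<zeta> M)"
| "ren \<xi> \<zeta> (App M e) = App (ren \<xi> \<zeta> M) (ren_elim \<xi> \<zeta> e)"
| "ren \<xi> \<zeta> (Pair M N) = Pair (ren \<xi> \<zeta> M) (ren \<xi> \<zeta> N)"
| "ren \<xi> \<zeta> (Inj1 M) = Inj1 (ren \<xi> \<zeta> M)"
| "ren \<xi> \<zeta> (Inj2 M) = Inj2 (ren \<xi> \<zeta> M)"
| "ren \<xi> \<zeta> (Mu M) = Mu (ren \<xi> (up \<zeta>) M)"
| "ren \<xi> \<zeta> (CApp a M) = CApp (\<zeta> a) (ren \<xi> \<zeta> M)"
| "ren_elim \<xi> \<zeta> (Tm M) = Tm (ren \<xi> \<zeta> M)"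
| "ren_elim \<xi> \<zeta> Proj1 = Proj1"
| "ren_elim \<xi> \<zeta> Proj2 = Proj2"
| "ren_elim \<xi> \<zeta> (Case M N) = Case (ren (up \<xi>) \<zeta> M) (ren (up \<xi>) \<zeta> N)"

text \<open>
  A subterm \<open>(a N)\<close> becomes \<open>(\<zeta> a) (N \<kappa> a)\<close>, with \<open>\<kappa> a\<close> a sequence of eliminators. Lifting,
  \<open>subst\<close> and \<open>msubst\<close> are all instances.
\<close>

abbreviation up_i :: "(nat \<Rightarrow> trm) \<Rightarrow> nat \<Rightarrow> trm" where
  "up_i \<sigma> \<equiv> case_nat (IVar 0) (\<lambda>i. ren Suc id (\<sigma> i))"

abbreviation up_c :: "(nat \<Rightarrow> elim list) \<Rightarrow> nat \<Rightarrow> elim list" where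
  "up_c \<kappa> \<equiv> case_nat [] (\<lambda>a. map (ren_elim id Suc) (\<kappa> a))"

primrec sb :: "(nat \<Rightarrow> trm) \<Rightarrow> (nat \<Rightarrow> nat) \<Rightarrow> (nat \<Rightarrow> elim list) \<Rightarrow> trm \<Rightarrow> trm"
  and sb_elim :: "(nat \<Rightarrow> trm) \<Rightarrow> (nat \<Rightarrow> nat) \<Rightarrow> (nat \<Rightarrow> elim list) \<Rightarrow> elim \<Rightarrow> elim" where
  "sb \<sigma> \<zeta> \<kappa> (IVar i) = \<sigma> i"
| "sb \<sigma> \<zeta> \<kappa> (Lam M) = Lam (sb (up_i \<sigma>) \<zeta> (\<lambda>a. map (ren_elim Suc id) (\<kappa> a)) M)"
| "sb \<sigma> \<zeta> \<kappa> (App M e) = App (sb \<sigma> \<zeta> \<kappa> M) (sb_elim \<sigma> \<zeta> \<kappa> e)"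
| "sb \<sigma> \<zeta> \<kappa> (Pair M N) = Pair (sb \<sigma> \<zeta> \<kappa> M) (sb \<sigma> \<zeta> \<kappa> N)"
| "sb \<sigma> \<zeta> \<kappa> (Inj1 M) = Inj1 (sb \<sigma> \<zeta> \<kappa> M)"
| "sb \<sigma> \<zeta> \<kappa> (Inj2 M) = Inj2 (sb \<sigma> \<zeta> \<kappa> M)"
| "sb \<sigma> \<zeta> \<kappa> (Mu M) = Mu (sb (\<lambda>i. ren id Suc (\<sigma> i)) (up \<zeta>) (up_c \<kappa>) M)"
| "sb \<sigma> \<zeta> \<kappa> (CApp a M) = CApp (\<zeta> a) (apps (sb \<sigma> \<zeta> \<kappa> M) (\<kappa> a))"
| "sb_elim \<sigma> \<zeta> \<kappa> (Tm M) = Tm (sb \<sigma> \<zeta> \<kappa> M)"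
| "sb_elim \<sigma> \<zeta> \<kappa> Proj1 = Proj1"
| "sb_elim \<sigma> \<zeta> \<kappa> Proj2 = Proj2"
| "sb_elim \<sigma> \<zeta> \<kappa> (Case M N) =
     Case (sb (up_i \<sigma>) \<zeta> (\<lambda>a. map (ren_elim Suc id) (\<kappa> a)) M)
          (sb (up_i \<sigma>) \<zeta> (\<lambda>a. map (ren_elim Suc id) (\<kappa> a)) N)"

lemma ren_cong: "\<xi> = \<xi>' \<Longrightarrow> \<zeta> = \<zeta>' \<Longrightarrow> ren \<xi> \<zeta> M = ren \<xi>' \<zeta>' M"
  by simp

lemma sb_cong: "\<sigma> = \<sigma>' \<Longrightarrow> \<zeta> = \<zeta>' \<Longrightarrow> \<kappa> = \<kappa>' \<Longrightarrow> sb \<sigma> \<zeta> \<kappa> M = sb \<sigma>' \<zeta>' \<kappa>' M"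
  by simp

text \<open>The composition laws form a ladder: \<open>ren_ren\<close> is read off by viewing
  renamings as substitutions, crossing a binder in \<open>ren_sb\<close> uses
  \<open>ren_ren\<close>, and crossing one in \<open>sb_sb\<close> uses \<open>sb_ren\<close> and
  \<open>ren_sb\<close>.\<close>

lemma sb_ren:
  "sb \<sigma> \<zeta> \<kappa> (ren \<xi> \<eta> M) = sb (\<lambda>i. \<sigma> (\<xi> i)) (\<lambda>a. \<zeta> (\<eta> a)) (\<lambda>a. \<kappa> (\<eta> a)) M"
  "sb_elim \<sigma> \<zeta> \<kappa> (ren_elim \<xi> \<eta> e) = sb_elim (\<lambda>i. \<sigma> (\<xi> i)) (\<lambda>a. \<zeta> (\<eta> a)) (\<lambda>a. \<kappa> (\<eta> a)) e"
proof (induct M and e arbitrary: \<sigma> \<zeta> \<kappa> \<xi> \<eta> and \<sigma> \<zeta> \<kappa> \<xi> \<eta> rule: trm.induct elim.induct)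
qed (auto intro!: sb_cong
       simp: fun_eq_iff split: nat.split)

lemma ren_eq_sb:
  "ren \<xi> \<eta> M = sb (\<lambda>i. IVar (\<xi> i)) \<eta> (\<lambda>_. []) M"
  "ren_elim \<xi> \<eta> e = sb_elim (\<lambda>i. IVar (\<xi> i)) \<eta> (\<lambda>_. []) e"
proof (induct M and e arbitrary: \<xi> \<eta> and \<xi> \<eta> rule: trm.induct elim.induct)
qed (auto intro!: sb_cong
       simp: fun_eq_iff split: nat.split)

lemma ren_ren:
  "ren \<xi> \<eta> (ren \<xi>' \<eta>' M) = ren (\<lambda>i. \<xi> (\<xi>' i)) (\<lambda>a. \<eta> (\<eta>' a)) M"
  "ren_elim \<xi> \<eta> (ren_elim \<xi>' \<eta>' e) = ren_elim (\<lambda>i. \<xi> (\<xi>' i)) (\<lambda>a. \<eta> (\<eta>' a)) e"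
  by (simp_all add: ren_eq_sb(1)[of \<xi> \<eta>] ren_eq_sb(2)[of \<xi> \<eta>] sb_ren)
     (simp_all add: ren_eq_sb)

lemma ren_apps: "ren \<xi> \<eta> (apps M Ts) = apps (ren \<xi> \<eta> M) (map (ren_elim \<xi> \<eta>) Ts)"
  by (induct Ts arbitrary: M) auto

lemma sb_apps: "sb \<sigma> \<zeta> \<kappa> (apps M Ts) = apps (sb \<sigma> \<zeta> \<kappa> M) (map (sb_elim \<sigma> \<zeta> \<kappa>) Ts)"
  by (induct Ts arbitrary: M) auto

lemma ren_sb:
  "ren \<xi> \<eta> (sb \<sigma> \<zeta> \<kappa> M) =
     sb (\<lambda>i. ren \<xi> \<eta> (\<sigma> i)) (\<lambda>a. \<eta> (\<zeta> a)) (\<lambda>a. map (ren_elim \<xi> \<eta>) (\<kappa> a)) M"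
  "ren_elim \<xi> \<eta> (sb_elim \<sigma> \<zeta> \<kappa> e) =
     sb_elim (\<lambda>i. ren \<xi> \<eta> (\<sigma> i)) (\<lambda>a. \<eta> (\<zeta> a)) (\<lambda>a. map (ren_elim \<xi> \<eta>) (\<kappa> a)) e"
proof (induct M and e arbitrary: \<sigma> \<zeta> \<kappa> \<xi> \<eta> and \<sigma> \<zeta> \<kappa> \<xi> \<eta> rule: trm.induct elim.induct)
qed (auto intro!: sb_cong
       simp: fun_eq_iff ren_ren ren_apps split: nat.split)

text \<open>\<open>(a N)\<close> first acquires the eliminators \<open>\<kappa> a\<close>, into
  which the outer substitution then enters; the renamed variable \<open>\<zeta> a\<close>
  contributes its own \<open>\<kappa>' (\<zeta> a)\<close> behind them. Hence the append in this
  order.\<close>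

lemma sb_sb:
  "sb \<sigma>' \<zeta>' \<kappa>' (sb \<sigma> \<zeta> \<kappa> M) =
     sb (\<lambda>i. sb \<sigma>' \<zeta>' \<kappa>' (\<sigma> i)) (\<lambda>a. \<zeta>' (\<zeta> a)) (\<lambda>a. map (sb_elim \<sigma>' \<zeta>' \<kappa>') (\<kappa> a) @ \<kappa>' (\<zeta> a)) M"
  "sb_elim \<sigma>' \<zeta>' \<kappa>' (sb_elim \<sigma> \<zeta> \<kappa> e) =
     sb_elim (\<lambda>i. sb \<sigma>' \<zeta>' \<kappa>' (\<sigma> i)) (\<lambda>a. \<zeta>' (\<zeta> a)) (\<lambda>a. map (sb_elim \<sigma>' \<zeta>' \<kappa>') (\<kappa> a) @ \<kappa>' (\<zeta> a)) e"
proof (induct M and e arbitrary: \<sigma> \<zeta> \<kappa> \<sigma>' \<zeta>' \<kappa>' and \<sigma> \<zeta> \<kappa> \<sigma>' \<zeta>' \<kappa>' rule: trm.induct elim.induct)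
qed (auto intro!: sb_cong
       simp: fun_eq_iff sb_ren ren_sb sb_apps split: nat.split)

lemma sb_id [simp]: "sb IVar id (\<lambda>_. []) M = M" "sb_elim IVar id (\<lambda>_. []) e = e"
proof (induct M and e rule: trm.induct elim.induct)
  case (Lam M)
  moreover have "up_i IVar = IVar" by (auto simp: fun_eq_iff split: nat.split)
  ultimately show ?case by simp
next
  case (Case M N)
  moreover have "up_i IVar = IVar" by (auto simp: fun_eq_iff split: nat.split)
  ultimately show ?case by simp
next
  case (Mu M)
  moreover have "up id = id" "up_c (\<lambda>_. []) = (\<lambda>_. [])" by (auto simp: fun_eq_iff split: nat.split)
  ultimately show ?case by (simp add: id_def)
qed auto

lemma sb_IVar [simp]:
  "sb IVar \<zeta> (\<lambda>_. []) M = ren id \<zeta> M" "sb_elim IVar \<zeta> (\<lambda>_. []) e = ren_elim id \<zeta> e"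
  by (simp_all add: ren_eq_sb)

lemma ren_id [simp]: "ren id id = id" "ren_elim id id = id"
  using ren_eq_sb(1)[of id id] ren_eq_sb(2)[of id id] by (simp_all add: fun_eq_iff del: sb_IVar)

lemma lift_i_ren:
  "lift_i k M = ren (\<lambda>i. if i < k then i else Suc i) id M"
  "lift_i_elim k e = ren_elim (\<lambda>i. if i < k then i else Suc i) id e"
proof (induct M and e arbitrary: k and k rule: trm.induct elim.induct)
qed (auto intro!: ren_cong
       simp: fun_eq_iff split: nat.split)

lemma lift_c_ren:
  "lift_c k M = ren id (\<lambda>i. if i < k then i else Suc i) M"
  "lift_c_elim k e = ren_elim id (\<lambda>i. if i < k then i else Suc i) e"
proof (induct M and e arbitrary: k and k rule: trm.induct elim.induct)
qed (auto intro!: ren_cong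
       simp: fun_eq_iff split: nat.split)

lemma lift_0:
  "lift_i 0 = ren Suc id" "lift_i_elim 0 = ren_elim Suc id"
  "lift_c 0 = ren id Suc" "lift_c_elim 0 = ren_elim id Suc"
  by (simp_all add: fun_eq_iff lift_i_ren lift_c_ren)

lemma subst_sb:
  "subst k P M = sb (\<lambda>i. if i < k then IVar i else if i = k then P else IVar (i - 1)) id (\<lambda>_. []) M"
  "subst_elim k P e = sb_elim (\<lambda>i. if i < k then IVar i else if i = k then P else IVar (i - 1)) id (\<lambda>_. []) e"
proof (induct M and e arbitrary: k P and k P rule: trm.induct elim.induct)
qed (auto intro!: sb_cong
       simp: fun_eq_iff lift_0 split: nat.split)

lemma msubst_sb:
  "msubst a f M = sb IVar id (\<lambda>b. if b = a then [f] else []) M"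
  "msubst_elim a f e = sb_elim IVar id (\<lambda>b. if b = a then [f] else []) e"
proof (induct M and e arbitrary: a f and a f rule: trm.induct elim.induct)
qed (auto intro!: sb_cong
       simp: fun_eq_iff lift_0 split: nat.split)

section \<open>Reduction of terms and of sequences of eliminators\<close>

inductive_cases red_elim_TmE: "red_elim (Tm M) e"
inductive_cases red_elim_CaseE: "red_elim (Case M N) e"
inductive_cases red_elim_Proj1E: "red_elim Proj1 e"
inductive_cases red_elim_Proj2E: "red_elim Proj2 e"
inductive_cases red_IVarE: "red (IVar i) M"
inductive_cases red_LamE: "red (Lam M) N"
inductive_cases red_PairE: "red (Pair M1 M2) N"
inductive_cases red_Inj1E: "red (Inj1 M) N"
inductive_cases red_Inj2E: "red (Inj2 M) N"
inductive_cases red_MuE: "red (Mu M) N"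
inductive_cases red_CAppE: "red (CApp a M) N"
inductive_cases red_AppE: "red (App M e) N"
inductive_cases contractE: "contract (App M e) N"

text \<open>
  The last rule is the permutative conversion of \<open>apps M (Case N1 N2 # e # Ts)\<close>, which does not
  involve \<open>M\<close>.
\<close>

inductive sred :: "elim list \<Rightarrow> elim list \<Rightarrow> bool" where
  sred_head: "red_elim e e' \<Longrightarrow> sred (e # Ts) (e' # Ts)"
| sred_tail: "sred Ts Ts' \<Longrightarrow> sred (e # Ts) (e # Ts')"
| sred_Case: "sred (Case N1 N2 # e # Ts)
    (Case (App N1 (ren_elim Suc id e)) (App N2 (ren_elim Suc id e)) # Ts)"

lemma red_apps_left: "red M M' \<Longrightarrow> red (apps M Ts) (apps M' Ts)"
  by (induct Ts arbitrary: M M') (auto intro: red_red_elim.intros)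

lemma red_apps_right: "sred Ts Ts' \<Longrightarrow> red (apps M Ts) (apps M Ts')"
proof (induct arbitrary: M rule: sred.induct)
  case (sred_Case N1 N2 e Ts)
  have "contract (App (App M (Case N1 N2)) e)
          (App M (Case (App N1 (ren_elim Suc id e)) (App N2 (ren_elim Suc id e))))"
    by (metis C_Case lift_0(2))
  then show ?case by (simp add: red_apps_left red_red_elim.intros)
qed (auto intro: red_apps_left red_red_elim.intros)

text \<open>Permutations among the eliminators are already part of \<open>sred\<close>, so the only
  other interaction is at the border between \<open>M\<close> and the first eliminator. This case
  distinction drives the termination proofs for terms \<open>apps M Ts\<close>.\<close>

lemma red_apps_cases:
  assumes "red (apps M Ts) X"
  obtains (left) M' where "red M M'" "X = apps M' Ts"
  | (right) Ts' where "sred Ts Ts'" "X = apps M Ts'"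
  | (root) e Us M' where "Ts = e # Us" "contract (App M e) M'" "X = apps M' Us"
proof -
  have "(\<exists>M'. red M M' \<and> X = apps M' Ts) \<or> (\<exists>Ts'. sred Ts Ts' \<and> X = apps M Ts') \<or>
      (\<exists>e Us M'. Ts = e # Us \<and> contract (App M e) M' \<and> X = apps M' Us)"
    using assms
  proof (induct Ts arbitrary: M)
    case Nil
    then show ?case by simp
  next
    case (Cons e Ts)
    from Cons.prems have "red (apps (App M e) Ts) X" by simp
    from Cons.hyps[OF this] consider M' where "red (App M e) M'" "X = apps M' Ts"
      | Ts' where "sred Ts Ts'" "X = apps (App M e) Ts'"
      | e' Us M' where "Ts = e' # Us" "contract (App (App M e) e') M'" "X = apps M' Us"
      by blast
    then show ?case
    proof cases
      case 1
      from 1(1) show ?thesis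
      proof (rule red_AppE)
        fix e' assume e': "M' = App M e'" "red_elim e e'"
        with 1(2) have "X = apps M (e' # Ts)" by simp
        with e' show ?thesis by (blast intro: sred_head)
      qed (use 1 in auto)
    next
      case 2
      then have "X = apps M (e # Ts')" by simp
      with 2 show ?thesis by (blast intro: sred_tail)
    next
      case 3
      \<comment> \<open>A redex whose function part is the application \<open>App M e\<close> can
        only be permutative, so \<open>e\<close> is a \<open>Case\<close> and the contraction is a
        step of the sequence.\<close>
      from 3(2) obtain N1 N2 where e: "e = Case N1 N2"
        and M': "M' = App M (Case (App N1 (ren_elim Suc id e')) (App N2 (ren_elim Suc id e')))"
        by (auto elim: contractE simp: lift_0)
      have "X = apps M (Case (App N1 (ren_elim Suc id e')) (App N2 (ren_elim Suc id e')) # Us)"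
        using 3 M' by simp
      then show ?thesis unfolding e 3(1) by (blast intro: sred_Case)
    qed
  qed
  then show ?thesis using that by blast
qed

section \<open>Stability of reduction under substitution\<close>

lemma sb_subst:
  "sb \<sigma> \<zeta> \<kappa> (subst 0 P M) =
     subst 0 (sb \<sigma> \<zeta> \<kappa> P) (sb (up_i \<sigma>) \<zeta> (\<lambda>a. map (ren_elim Suc id) (\<kappa> a)) M)"
  by (auto intro!: sb_cong simp: subst_sb sb_sb sb_ren fun_eq_iff id_def[symmetric] o_def
    split: nat.split)

lemma sb_msubst:
  "sb (\<lambda>i. ren id Suc (\<sigma> i)) (up \<zeta>) (up_c \<kappa>) (msubst 0 (lift_c_elim 0 e) M) =
     msubst 0 (lift_c_elim 0 (sb_elim \<sigma> \<zeta> \<kappa> e)) (sb (\<lambda>i. ren id Suc (\<sigma> i)) (up \<zeta>) (up_c \<kappa>) M)"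
  by (auto intro!: sb_cong simp: msubst_sb sb_sb sb_ren ren_sb lift_0 fun_eq_iff o_def
    split: nat.split)

lemma contract_sb: "contract M M' \<Longrightarrow> contract (sb \<sigma> \<zeta> \<kappa> M) (sb \<sigma> \<zeta> \<kappa> M')"
proof (induct rule: contract.induct)
  case (C_Case M N1 N2 e)
  have "sb_elim (up_i \<sigma>) \<zeta> (\<lambda>a. map (ren_elim Suc id) (\<kappa> a)) (lift_i_elim 0 e) =
      lift_i_elim 0 (sb_elim \<sigma> \<zeta> \<kappa> e)"
    by (simp add: lift_0 sb_ren ren_sb)
  then show ?case by (simp add: contract.C_Case)
qed (auto simp: sb_subst sb_msubst intro: contract.intros)

text \<open>One step goes to exactly one step, never to none: redexes persist, and
  \<open>\<kappa>\<close> only appends eliminators behind the bodies of subterms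
  \<open>(a N)\<close>. Hence termination of an instance yields termination of the term
  itself.\<close>

lemma red_sb:
  "red M M' \<Longrightarrow> red (sb \<sigma> \<zeta> \<kappa> M) (sb \<sigma> \<zeta> \<kappa> M')"
  "red_elim e e' \<Longrightarrow> red_elim (sb_elim \<sigma> \<zeta> \<kappa> e) (sb_elim \<sigma> \<zeta> \<kappa> e')"
proof (induct arbitrary: \<sigma> \<zeta> \<kappa> and \<sigma> \<zeta> \<kappa> rule: red_red_elim.inducts)
  case (10 M M' a)
  then show ?case by (simp add: red_apps_left red_red_elim.intros(10))
qed (auto intro: red_red_elim.intros contract_sb)

lemma sred_sb: "sred Ts Ts' \<Longrightarrow> sred (map (sb_elim \<sigma> \<zeta> \<kappa>) Ts) (map (sb_elim \<sigma> \<zeta> \<kappa>) Ts')"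
proof (induct rule: sred.induct)
  case (sred_Case N1 N2 e Ts)
  have "sb_elim (up_i \<sigma>) \<zeta> (\<lambda>a. map (ren_elim Suc id) (\<kappa> a)) (ren_elim Suc id e) =
      ren_elim Suc id (sb_elim \<sigma> \<zeta> \<kappa> e)"
    by (simp add: sb_ren ren_sb)
  then show ?case by (simp add: sred.sred_Case)
qed (auto intro: sred.intros red_sb)

lemma red_ren: "red M M' \<Longrightarrow> red (ren \<xi> \<zeta> M) (ren \<xi> \<zeta> M')"
  by (simp add: ren_eq_sb red_sb)

lemma sred_ren: "sred Ts Ts' \<Longrightarrow> sred (map (ren_elim \<xi> \<zeta>) Ts) (map (ren_elim \<xi> \<zeta>) Ts')"
  using sred_sb[of Ts Ts' "\<lambda>i. IVar (\<xi> i)" \<zeta> "\<lambda>_. []"] by (simp add: ren_eq_sb(2)[symmetric] cong: map_cong)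

lemma rtranclp_map: "r\<^sup>*\<^sup>* x y \<Longrightarrow> (\<And>x y. r x y \<Longrightarrow> s (f x) (f y)) \<Longrightarrow> s\<^sup>*\<^sup>* (f x) (f y)"
  by (induct rule: rtranclp_induct) (auto intro: rtranclp.rtrancl_into_rtrancl)

lemma reds_ren: "red\<^sup>*\<^sup>* M M' \<Longrightarrow> red\<^sup>*\<^sup>* (ren \<xi> \<zeta> M) (ren \<xi> \<zeta> M')"
  by (erule rtranclp_map) (rule red_ren)

lemma sreds_ren:
  "sred\<^sup>*\<^sup>* Ts Ts' \<Longrightarrow> sred\<^sup>*\<^sup>* (map (ren_elim \<xi> \<zeta>) Ts) (map (ren_elim \<xi> \<zeta>) Ts')"
  by (erule rtranclp_map) (rule sred_ren)

lemma reds_Lam: "red\<^sup>*\<^sup>* M M' \<Longrightarrow> red\<^sup>*\<^sup>* (Lam M) (Lam M')"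
  by (erule rtranclp_map) (rule red_red_elim.intros)

lemma reds_Mu: "red\<^sup>*\<^sup>* M M' \<Longrightarrow> red\<^sup>*\<^sup>* (Mu M) (Mu M')"
  by (erule rtranclp_map) (rule red_red_elim.intros)

lemma reds_Inj1: "red\<^sup>*\<^sup>* M M' \<Longrightarrow> red\<^sup>*\<^sup>* (Inj1 M) (Inj1 M')"
  by (erule rtranclp_map) (rule red_red_elim.intros)

lemma reds_Inj2: "red\<^sup>*\<^sup>* M M' \<Longrightarrow> red\<^sup>*\<^sup>* (Inj2 M) (Inj2 M')"
  by (erule rtranclp_map) (rule red_red_elim.intros)

lemma reds_CApp: "red\<^sup>*\<^sup>* M M' \<Longrightarrow> red\<^sup>*\<^sup>* (CApp a M) (CApp a M')"
  by (erule rtranclp_map) (rule red_red_elim.intros)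

lemma reds_Tm: "red\<^sup>*\<^sup>* M M' \<Longrightarrow> red_elim\<^sup>*\<^sup>* (Tm M) (Tm M')"
  by (erule rtranclp_map) (rule red_red_elim.intros)

lemma reds_App: "red\<^sup>*\<^sup>* M M' \<Longrightarrow> red_elim\<^sup>*\<^sup>* e e' \<Longrightarrow> red\<^sup>*\<^sup>* (App M e) (App M' e')"
  by (rule rtranclp_trans[of _ _ "App M' e"]; erule rtranclp_map) (auto intro: red_red_elim.intros)

lemma reds_Pair: "red\<^sup>*\<^sup>* M M' \<Longrightarrow> red\<^sup>*\<^sup>* N N' \<Longrightarrow> red\<^sup>*\<^sup>* (Pair M N) (Pair M' N')"
  by (rule rtranclp_trans[of _ _ "Pair M' N"]; erule rtranclp_map) (auto intro: red_red_elim.intros)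

lemma reds_Case: "red\<^sup>*\<^sup>* M M' \<Longrightarrow> red\<^sup>*\<^sup>* N N' \<Longrightarrow> red_elim\<^sup>*\<^sup>* (Case M N) (Case M' N')"
  by (rule rtranclp_trans[of _ _ "Case M' N"]; erule rtranclp_map) (auto intro: red_red_elim.intros)

lemma reds_apps: "red\<^sup>*\<^sup>* M M' \<Longrightarrow> sred\<^sup>*\<^sup>* Ts Ts' \<Longrightarrow> red\<^sup>*\<^sup>* (apps M Ts) (apps M' Ts')"
  by (rule rtranclp_trans[of _ _ "apps M' Ts"]; erule rtranclp_map)
    (auto intro: red_apps_left red_apps_right)

lemmas reds_intros = reds_Lam reds_Mu reds_Inj1 reds_Inj2 reds_CApp reds_Tm reds_App reds_Pair
  reds_Case reds_apps

text \<open>The substituted objects may occur several times or not at all, so even a single step in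
  them becomes a reduction of arbitrary, possibly zero, length.\<close>

lemma sb_reds:
  "(\<And>i. red\<^sup>*\<^sup>* (\<sigma> i) (\<sigma>' i)) \<Longrightarrow> (\<And>a. sred\<^sup>*\<^sup>* (\<kappa> a) (\<kappa>' a)) \<Longrightarrow>
     red\<^sup>*\<^sup>* (sb \<sigma> \<zeta> \<kappa> M) (sb \<sigma>' \<zeta> \<kappa>' M)"
  "(\<And>i. red\<^sup>*\<^sup>* (\<sigma> i) (\<sigma>' i)) \<Longrightarrow> (\<And>a. sred\<^sup>*\<^sup>* (\<kappa> a) (\<kappa>' a)) \<Longrightarrow>
     red_elim\<^sup>*\<^sup>* (sb_elim \<sigma> \<zeta> \<kappa> e) (sb_elim \<sigma>' \<zeta> \<kappa>' e)"
proof (induct M and e arbitrary: \<sigma> \<zeta> \<kappa> \<sigma>' \<kappa>' and \<sigma> \<zeta> \<kappa> \<sigma>' \<kappa>' rule: trm.induct elim.induct)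
  case (Lam M)
  show ?case unfolding sb.simps
    by (intro reds_intros Lam.hyps) (auto intro: Lam.prems reds_ren sreds_ren split: nat.split)
next
  case (Mu M)
  show ?case unfolding sb.simps
    by (intro reds_intros Mu.hyps) (auto intro: Mu.prems reds_ren sreds_ren split: nat.split)
next
  case (Case M N)
  show ?case unfolding sb_elim.simps
    by (intro reds_intros Case.hyps) (auto intro: Case.prems reds_ren sreds_ren split: nat.split)
qed (auto intro!: reds_intros)

section \<open>Strong normalization\<close>

text \<open>The accessible part of the relation, preferred to the absence of infinite sequences for
  its induction principle; \<open>terminating_SN\<close> leads back to \<open>SN\<close>.\<close>

inductive terminating :: "('a \<Rightarrow> 'a \<Rightarrow> bool) \<Rightarrow> 'a \<Rightarrow> bool" for r where
  terminatingI: "(\<And>y. r x y \<Longrightarrow> terminating r y) \<Longrightarrow> terminating r x"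

abbreviation sn :: "trm \<Rightarrow> bool" where
  "sn \<equiv> terminating red"

text \<open>The restriction to terminating elements makes this relation well-founded outright, so
  that lexicographic products of it are well-founded too. The transitive closure accommodates
  components that take several steps at once.\<close>

definition descent :: "('a \<Rightarrow> 'a \<Rightarrow> bool) \<Rightarrow> ('a \<times> 'a) set" where
  "descent r = {(y, x). r\<^sup>+\<^sup>+ x y \<and> terminating r x}"

lemma terminating_step: "terminating r x \<Longrightarrow> r x y \<Longrightarrow> terminating r y"
  by (erule terminating.cases) simp

lemma terminating_steps: "r\<^sup>*\<^sup>* x y \<Longrightarrow> terminating r x \<Longrightarrow> terminating r y"
  by (induct rule: rtranclp_induct) (auto intro: terminating_step)

lemma terminating_map:
  assumes "terminating s (f x)" and "\<And>x y. r x y \<Longrightarrow> s (f x) (f y)"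
  shows "terminating r x"
  using assms(1)
proof (induct "f x" arbitrary: x rule: terminating.induct)
  case (terminatingI y)
  show ?case by (rule terminating.terminatingI) (rule terminatingI(2)[OF assms(2)])
qed

lemma wf_descent: "wf (descent r)"
proof -
  let ?R = "{(y, x). r x y \<and> terminating r x}"
  have "wf ?R"
  proof (rule wfUNIVI)
    fix P :: "'a \<Rightarrow> bool" and x
    assume P: "\<forall>x. (\<forall>y. (y, x) \<in> ?R \<longrightarrow> P y) \<longrightarrow> P x"
    have P': "P x" if "\<And>y. r x y \<Longrightarrow> terminating r x \<Longrightarrow> P y" for x
      using P[rule_format, of x] that by simp
    show "P x"
    proof (cases "terminating r x")
      case True
      then show ?thesis by (induct rule: terminating.induct) (rule P')
    next
      case False
      \<comment> \<open>A non-terminating element has nothing below it in \<open>?R\<close>.\<close>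
      show ?thesis by (rule P') (rule notE[OF False])
    qed
  qed
  moreover have "(y, x) \<in> ?R\<^sup>+" if xy: "r\<^sup>+\<^sup>+ x y" and x: "terminating r x" for x y
    using xy
  proof (induct rule: tranclp_induct)
    case (base y)
    then show ?case using x by (intro r_into_trancl) simp
  next
    case (step y z)
    have "terminating r y"
      by (rule terminating_steps[OF tranclp_into_rtranclp[OF step(1)] x])
    then have "(z, y) \<in> ?R" using step(2) by simp
    then show ?case using step(3) by (rule trancl_into_trancl2)
  qed
  then have "descent r \<subseteq> ?R\<^sup>+" unfolding descent_def by blast
  ultimately show ?thesis by (rule wf_subset[OF wf_trancl])
qed

lemma descent_step: "r x y \<Longrightarrow> terminating r x \<Longrightarrow> (y, x) \<in> descent r"
  by (auto simp: descent_def)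

text \<open>The first component is allowed to stand still; the descent then comes from the
  second.\<close>

lemma descent_lexI:
  "r\<^sup>*\<^sup>* x x' \<Longrightarrow> terminating r x \<Longrightarrow> (y', y) \<in> S \<Longrightarrow> ((x', y'), (x, y)) \<in> descent r <*lex*> S"
  by (auto simp: descent_def dest: rtranclpD)

lemma descent_lexI':
  "r x x' \<Longrightarrow> terminating r x \<Longrightarrow> ((x', y'), (x, y)) \<in> descent r <*lex*> S"
  by (auto simp: descent_step)

inductive_cases sred_NilE: "sred [] Ts"
inductive_cases sred_ConsE: "sred (e # Ts) Us"

lemma red_subst: "red M M' \<Longrightarrow> red (subst 0 N M) (subst 0 N M')"
  by (simp add: subst_sb red_sb)

lemma reds_subst: "red N N' \<Longrightarrow> red\<^sup>*\<^sup>* (subst 0 N M) (subst 0 N' M)"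
  unfolding subst_sb by (rule sb_reds) auto

lemma terminating_map':
  assumes "terminating r x" "\<And>x z. s (f x) z \<Longrightarrow> \<exists>y. z = f y \<and> r x y"
  shows "terminating s (f x)"
  using assms(1)
proof (induct rule: terminating.induct)
  case (terminatingI x)
  show ?case
    by (rule terminating.terminatingI) (use assms(2) terminatingI(2) in blast)
qed

section \<open>Termination of terms without a head redex and of sequences of eliminators\<close>

lemma sn_Lam: "sn M \<Longrightarrow> sn (Lam M)"
  by (erule terminating_map') (auto elim: red_LamE contract.cases)

lemma sn_Inj1: "sn M \<Longrightarrow> sn (Inj1 M)"
  by (erule terminating_map') (auto elim: red_Inj1E contract.cases)

lemma sn_Inj2: "sn M \<Longrightarrow> sn (Inj2 M)"
  by (erule terminating_map') (auto elim: red_Inj2E contract.cases)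

lemma sn_CApp: "sn M \<Longrightarrow> sn (CApp a M)"
  by (erule terminating_map') (auto elim: red_CAppE contract.cases)

lemma sn_Tm: "sn M \<Longrightarrow> terminating red_elim (Tm M)"
  by (erule terminating_map') (auto elim: red_elim_TmE)

lemma sn_Pair:
  assumes "sn M" "sn N"
  shows "sn (Pair M N)"
proof -
  have "wf (descent red <*lex*> descent red)" by (intro wf_lex_prod wf_descent)
  then show ?thesis using assms
  proof (induct "(M, N)" arbitrary: M N rule: wf_induct_rule)
    case less
    show ?case
    proof (rule terminatingI)
      fix X assume "red (Pair M N) X"
      then show "sn X"
        by (rule red_PairE)
          (auto elim: contract.cases intro!: less descent_step intro: terminating_step)
    qed
  qed
qed

lemma sn_apps_IVar: "terminating sred Ts \<Longrightarrow> sn (apps (IVar i) Ts)"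
  by (erule terminating_map')
    (erule red_apps_cases, auto elim: red_IVarE contract.cases)

lemma terminating_sred_Nil: "terminating sred []"
  by (rule terminatingI) (auto elim: sred_NilE)

text \<open>An eliminator other than \<open>Case\<close> does not absorb its successor, and
  reduction never turns it into a \<open>Case\<close>; so \<open>e\<close> and \<open>Ts\<close>
  evolve independently.\<close>

lemma terminating_sred_Cons:
  assumes "terminating red_elim e" "terminating sred Ts" "\<And>N1 N2. e \<noteq> Case N1 N2"
  shows "terminating sred (e # Ts)"
proof -
  have "wf (descent red_elim <*lex*> descent sred)" by (intro wf_lex_prod wf_descent)
  then show ?thesis using assms
  proof (induct "(e, Ts)" arbitrary: e Ts rule: wf_induct_rule)
    case less
    show ?case
    proof (rule terminatingI)
      fix Us assume "sred (e # Ts) Us"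
      then show "terminating sred Us"
      proof (rule sred_ConsE)
        fix e' assume "Us = e' # Ts" "red_elim e e'"
        moreover from \<open>red_elim e e'\<close> have "e' \<noteq> Case N1 N2" for N1 N2
          using less.prems(3) by (cases rule: red_elim.cases) auto
        ultimately show ?thesis using less.prems
          by (auto intro!: less.hyps descent_step intro: terminating_step)
      next
        fix Ts' assume "Us = e # Ts'" "sred Ts Ts'"
        then show ?thesis using less.prems
          by (auto intro!: less.hyps descent_step intro: terminating_step)
      qed (use less.prems in auto)
    qed
  qed
qed

text \<open>
  Permuting the first eliminator \<open>e\<close> of \<open>Ts\<close> into the two branches changes neither of the
  two terms assumed to be strongly normalizing.
\<close>

lemma terminating_sred_Case:
  assumes "sn (apps N1 (map (ren_elim Suc id) Ts))" "sn (apps N2 (map (ren_elim Suc id) Ts))"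
  shows "terminating sred (Case N1 N2 # Ts)"
proof -
  let ?t = "\<lambda>N Ts. apps N (map (ren_elim Suc id) Ts)"
  have "wf (descent red <*lex*> descent red <*lex*> less_than)"
    by (intro wf_lex_prod wf_descent wf_less_than)
  then show ?thesis using assms
  proof (induct "(?t N1 Ts, ?t N2 Ts, length Ts)" arbitrary: N1 N2 Ts rule: wf_induct_rule)
    case less
    note IH = less.hyps and sn1 = less.prems(1) and sn2 = less.prems(2)
    show ?case
    proof (rule terminatingI)
      fix Us assume "sred (Case N1 N2 # Ts) Us"
      then show "terminating sred Us"
      proof (rule sred_ConsE)
        fix e' assume Us: "Us = e' # Ts" and "red_elim (Case N1 N2) e'"
        from this(2) show ?thesis
        proof (rule red_elim_CaseE)
          fix N1' assume "e' = Case N1' N2" "red N1 N1'"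
          moreover from this have "red (?t N1 Ts) (?t N1' Ts)" by (simp add: red_apps_left)
          ultimately show ?thesis unfolding Us
            by (auto intro!: IH sn1 sn2 descent_step intro: terminating_step)
        next
          fix N2' assume "e' = Case N1 N2'" "red N2 N2'"
          moreover from this have "red (?t N2 Ts) (?t N2' Ts)" by (simp add: red_apps_left)
          ultimately show ?thesis unfolding Us
            by (auto intro!: IH sn1 sn2 descent_step intro: terminating_step)
        qed
      next
        fix Ts' assume "Us = Case N1 N2 # Ts'" "sred Ts Ts'"
        moreover from this have "red (?t N Ts) (?t N Ts')" for N
          by (simp add: red_apps_right sred_ren)
        ultimately show ?thesis
          by (auto intro!: IH sn1 sn2 descent_step intro: terminating_step)
      next
        fix O1 O2 e Vs
        assume "Case N1 N2 = Case O1 O2" "Ts = e # Vs"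
          "Us = Case (App O1 (ren_elim Suc id e)) (App O2 (ren_elim Suc id e)) # Vs"
        then show ?thesis using sn1 sn2 by (auto intro!: IH)
      qed
    qed
  qed
qed

section \<open>Closure of termination under head expansion\<close>

lemma sn_apps_Lam:
  assumes "sn (apps (subst 0 N M) Ts)" "sn N"
  shows "sn (apps (Lam M) (Tm N # Ts))"
proof -
  \<comment> \<open>The contractum leads the measure, since steps in \<open>M\<close> and
    \<open>Ts\<close> show up in it. A step in \<open>N\<close> may leave it unchanged when the
    bound variable is absent, whence the second component and the separate assumption on
    \<open>N\<close>.\<close>
  have "wf (descent red <*lex*> descent red)" by (intro wf_lex_prod wf_descent)
  then show ?thesis using assms
  proof (induct "(apps (subst 0 N M) Ts, N)" arbitrary: M N Ts rule: wf_induct_rule)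
    case less
    note IH = less.hyps and sn = less.prems
    show ?case
    proof (rule terminatingI)
      fix X assume "red (apps (Lam M) (Tm N # Ts)) X"
      then show "sn X"
      proof (cases rule: red_apps_cases)
        case (left P)
        then obtain M' where M': "P = Lam M'" "red M M'"
          by (auto elim: red_LamE contract.cases)
        then have "red (apps (subst 0 N M) Ts) (apps (subst 0 N M') Ts)"
          by (simp add: red_apps_left red_subst)
        then show ?thesis unfolding left M'(1)
          using sn by (intro IH descent_lexI') (auto intro: terminating_step)
      next
        case (right Us)
        from right(1) show ?thesis
        proof (rule sred_ConsE)
          fix e assume "Us = e # Ts" "red_elim (Tm N) e"
          then obtain N' where N': "Us = Tm N' # Ts" "red N N'" by (auto elim: red_elim_TmE)
          then have "red\<^sup>*\<^sup>* (apps (subst 0 N M) Ts) (apps (subst 0 N' M) Ts)"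
            by (simp add: reds_apps reds_subst)
          then show ?thesis unfolding right N'(1)
            using sn N' by (intro IH descent_lexI descent_step) (auto intro: terminating_step terminating_steps)
        next
          fix Ts' assume Ts': "Us = Tm N # Ts'" "sred Ts Ts'"
          then have "red (apps (subst 0 N M) Ts) (apps (subst 0 N M) Ts')"
            by (simp add: red_apps_right)
          then show ?thesis unfolding right Ts'(1)
            using sn by (intro IH descent_lexI') (auto intro: terminating_step)
        qed auto
      next
        case root
        then show ?thesis using sn by (auto elim: contractE)
      qed
    qed
  qed
qed

text \<open>The component discarded by the projection is invisible in the contractum, so its
  termination is assumed and it becomes the second component of the measure.\<close>

lemma sn_apps_Proj1:
  assumes "sn (apps M1 Ts)" "sn M2"
  shows "sn (apps (Pair M1 M2) (Proj1 # Ts))"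
proof -
  have "wf (descent red <*lex*> descent red)" by (intro wf_lex_prod wf_descent)
  then show ?thesis using assms
  proof (induct "(apps M1 Ts, M2)" arbitrary: M1 M2 Ts rule: wf_induct_rule)
    case less
    note IH = less.hyps and sn = less.prems
    show ?case
    proof (rule terminatingI)
      fix X assume "red (apps (Pair M1 M2) (Proj1 # Ts)) X"
      then show "sn X"
      proof (cases rule: red_apps_cases)
        case (left P)
        from left(1) show ?thesis
        proof (rule red_PairE)
          fix M' assume M': "P = Pair M' M2" "red M1 M'"
          then show ?thesis unfolding left M'(1)
            using sn red_apps_left[of M1 M' Ts]
            by (intro IH) (auto intro: descent_step terminating_step)
        next
          fix M' assume M': "P = Pair M1 M'" "red M2 M'"
          then show ?thesis unfolding left M'(1)
            using sn red_apps_left[of M2 M' Ts]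
            by (intro IH) (auto intro: descent_step terminating_step)
        qed (auto elim: contract.cases)
      next
        case (right Us)
        then obtain Ts' where Ts': "Us = Proj1 # Ts'" "sred Ts Ts'"
          by (auto elim: sred_ConsE red_elim_Proj1E)
        then show ?thesis unfolding right Ts'(1)
          using sn red_apps_right[of Ts Ts' M1]
          by (intro IH) (auto intro: descent_step terminating_step)
      next
        case root
        then show ?thesis using sn by (auto elim: contractE)
      qed
    qed
  qed
qed

lemma sn_apps_Proj2:
  assumes "sn (apps M2 Ts)" "sn M1"
  shows "sn (apps (Pair M1 M2) (Proj2 # Ts))"
proof -
  have "wf (descent red <*lex*> descent red)" by (intro wf_lex_prod wf_descent)
  then show ?thesis using assms
  proof (induct "(apps M2 Ts, M1)" arbitrary: M1 M2 Ts rule: wf_induct_rule)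
    case less
    note IH = less.hyps and sn = less.prems
    show ?case
    proof (rule terminatingI)
      fix X assume "red (apps (Pair M1 M2) (Proj2 # Ts)) X"
      then show "sn X"
      proof (cases rule: red_apps_cases)
        case (left P)
        from left(1) show ?thesis
        proof (rule red_PairE)
          fix M' assume M': "P = Pair M' M2" "red M1 M'"
          then show ?thesis unfolding left M'(1)
            using sn red_apps_left[of M1 M' Ts]
            by (intro IH) (auto intro: descent_step terminating_step)
        next
          fix M' assume M': "P = Pair M1 M'" "red M2 M'"
          then show ?thesis unfolding left M'(1)
            using sn red_apps_left[of M2 M' Ts]
            by (intro IH) (auto intro: descent_step terminating_step)
        qed (auto elim: contract.cases)
      next
        case (right Us)
        then obtain Ts' where Ts': "Us = Proj2 # Ts'" "sred Ts Ts'"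
          by (auto elim: sred_ConsE red_elim_Proj2E)
        then show ?thesis unfolding right Ts'(1)
          using sn red_apps_right[of Ts Ts' M2]
          by (intro IH) (auto intro: descent_step terminating_step)
      next
        case root
        then show ?thesis using sn by (auto elim: contractE)
      qed
    qed
  qed
qed

text \<open>Lifting makes room for the branch variable and the substitution closes it again. Hence a
  permuted eliminator, which enters a branch lifted, reappears unchanged once the branch is
  instantiated.\<close>

lemma subst_elim_lift: "subst_elim 0 P (ren_elim Suc id e) = e"
  by (simp add: subst_sb sb_ren flip: id_def)

lemma subst_apps_lift:
  "subst 0 P (apps M (map (ren_elim Suc id) Ts)) = apps (subst 0 P M) Ts"
  by (induct Ts arbitrary: M) (auto simp: subst_elim_lift)

lemma sn_apps_Inj1:
  assumes "sn (apps (subst 0 M N1) Ts)" "sn (apps N2 (map (ren_elim Suc id) Ts))" "sn M"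
  shows "sn (apps (Inj1 M) (Case N1 N2 # Ts))"
proof -
  let ?s = "\<lambda>M N Ts. apps (subst 0 M N) Ts" and ?t = "\<lambda>N Ts. apps N (map (ren_elim Suc id) Ts)"
  \<comment> \<open>Steps in \<open>N1\<close> and \<open>Ts\<close> lower the first component,
    steps in \<open>N2\<close> the second; a step in \<open>M\<close> may be lost in the first and
    then lowers the third. A permutation changes none of these three and shortens
    \<open>Ts\<close>.\<close>
  have "wf (descent red <*lex*> descent red <*lex*> descent red <*lex*> less_than)"
    by (intro wf_lex_prod wf_descent wf_less_than)
  then show ?thesis using assms
  proof (induct "(?s M N1 Ts, ?t N2 Ts, M, length Ts)" arbitrary: M N1 N2 Ts rule: wf_induct_rule)
    case less
    note IH = less.hyps and sn = less.prems
    show ?case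
    proof (rule terminatingI)
      fix X assume "red (apps (Inj1 M) (Case N1 N2 # Ts)) X"
      then show "sn X"
      proof (cases rule: red_apps_cases)
        case (left P)
        then obtain M' where M': "P = Inj1 M'" "red M M'"
          by (auto elim: red_Inj1E contract.cases)
        then have "red\<^sup>*\<^sup>* (?s M N1 Ts) (?s M' N1 Ts)"
          by (simp add: reds_apps reds_subst)
        with M' show ?thesis unfolding left M'(1)
          using sn
          by (intro IH descent_lexI[OF _ _ descent_lexI[OF rtranclp.rtrancl_refl _ descent_lexI']])
            (auto intro: terminating_step terminating_steps)
      next
        case (right Us)
        from right(1) show ?thesis
        proof (rule sred_ConsE)
          fix e assume Us: "Us = e # Ts" and "red_elim (Case N1 N2) e"
          from this(2) show ?thesis
          proof (rule red_elim_CaseE)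
            fix N' assume N': "e = Case N' N2" "red N1 N'"
            then have "red (?s M N1 Ts) (?s M N' Ts)" by (simp add: red_apps_left red_subst)
            then show ?thesis unfolding right Us N'(1)
              using sn by (intro IH descent_lexI') (auto intro: terminating_step)
          next
            fix N' assume N': "e = Case N1 N'" "red N2 N'"
            then have "red (?t N2 Ts) (?t N' Ts)" by (simp add: red_apps_left)
            then show ?thesis unfolding right Us N'(1)
              using sn by (intro IH descent_lexI[OF rtranclp.rtrancl_refl] descent_lexI')
                (auto intro: terminating_step)
          qed
        next
          fix Ts' assume Ts': "Us = Case N1 N2 # Ts'" "sred Ts Ts'"
          then have "red (?s M N1 Ts) (?s M N1 Ts')" "red (?t N2 Ts) (?t N2 Ts')"
            by (simp_all add: red_apps_right sred_ren)
          then show ?thesis unfolding right Ts'(1)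
            using sn by (intro IH descent_lexI') (auto intro: terminating_step)
        next
          fix O1 O2 e Vs
          assume eq: "Case N1 N2 = Case O1 O2" "Ts = e # Vs"
            "Us = Case (App O1 (ren_elim Suc id e)) (App O2 (ren_elim Suc id e)) # Vs"
          show ?thesis unfolding right(2) eq(3)
            by (rule IH) (use sn eq in \<open>auto simp: subst_elim_lift\<close>)
        qed
      next
        case root
        then show ?thesis using sn by (auto elim: contractE)
      qed
    qed
  qed
qed

lemma sn_apps_Inj2:
  assumes "sn (apps (subst 0 M N2) Ts)" "sn (apps N1 (map (ren_elim Suc id) Ts))" "sn M"
  shows "sn (apps (Inj2 M) (Case N1 N2 # Ts))"
proof -
  let ?s = "\<lambda>M N Ts. apps (subst 0 M N) Ts" and ?t = "\<lambda>N Ts. apps N (map (ren_elim Suc id) Ts)"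
  have "wf (descent red <*lex*> descent red <*lex*> descent red <*lex*> less_than)"
    by (intro wf_lex_prod wf_descent wf_less_than)
  then show ?thesis using assms
  proof (induct "(?s M N2 Ts, ?t N1 Ts, M, length Ts)" arbitrary: M N1 N2 Ts rule: wf_induct_rule)
    case less
    note IH = less.hyps and sn = less.prems
    show ?case
    proof (rule terminatingI)
      fix X assume "red (apps (Inj2 M) (Case N1 N2 # Ts)) X"
      then show "sn X"
      proof (cases rule: red_apps_cases)
        case (left P)
        then obtain M' where M': "P = Inj2 M'" "red M M'"
          by (auto elim: red_Inj2E contract.cases)
        then have "red\<^sup>*\<^sup>* (?s M N2 Ts) (?s M' N2 Ts)"
          by (simp add: reds_apps reds_subst)
        with M' show ?thesis unfolding left M'(1)
          using sn
          by (intro IH descent_lexI[OF _ _ descent_lexI[OF rtranclp.rtrancl_refl _ descent_lexI']])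
            (auto intro: terminating_step terminating_steps)
      next
        case (right Us)
        from right(1) show ?thesis
        proof (rule sred_ConsE)
          fix e assume Us: "Us = e # Ts" and "red_elim (Case N1 N2) e"
          from this(2) show ?thesis
          proof (rule red_elim_CaseE)
            fix N' assume N': "e = Case N' N2" "red N1 N'"
            then have "red (?t N1 Ts) (?t N' Ts)" by (simp add: red_apps_left)
            then show ?thesis unfolding right Us N'(1)
              using sn by (intro IH descent_lexI[OF rtranclp.rtrancl_refl] descent_lexI')
                (auto intro: terminating_step)
          next
            fix N' assume N': "e = Case N1 N'" "red N2 N'"
            then have "red (?s M N2 Ts) (?s M N' Ts)" by (simp add: red_apps_left red_subst)
            then show ?thesis unfolding right Us N'(1)
              using sn by (intro IH descent_lexI') (auto intro: terminating_step)
          qed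
        next
          fix Ts' assume Ts': "Us = Case N1 N2 # Ts'" "sred Ts Ts'"
          then have "red (?s M N2 Ts) (?s M N2 Ts')" "red (?t N1 Ts) (?t N1 Ts')"
            by (simp_all add: red_apps_right sred_ren)
          then show ?thesis unfolding right Ts'(1)
            using sn by (intro IH descent_lexI') (auto intro: terminating_step)
        next
          fix O1 O2 e Vs
          assume eq: "Case N1 N2 = Case O1 O2" "Ts = e # Vs"
            "Us = Case (App O1 (ren_elim Suc id e)) (App O2 (ren_elim Suc id e)) # Vs"
          show ?thesis unfolding right(2) eq(3)
            by (rule IH) (use sn eq in \<open>auto simp: subst_elim_lift\<close>)
        qed
      next
        case root
        then show ?thesis using sn by (auto elim: contractE)
      qed
    qed
  qed
qed

text \<open>The body of a \<open>Mu\<close> that has absorbed all of \<open>Ts\<close>. The bound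
  variable keeps index 0, and \<open>Ts\<close> is shifted because it moves under the
  binder.\<close>

abbreviation msubsts :: "elim list \<Rightarrow> trm \<Rightarrow> trm" where
  "msubsts Ts \<equiv> sb IVar id (case_nat (map (ren_elim id Suc) Ts) (\<lambda>_. []))"

text \<open>The eliminators of \<open>Ts\<close> are appended after \<open>e\<close>, and the lifted
  \<open>e\<close> does not contain the bound variable, so nothing is substituted into it.\<close>

lemma msubsts_Cons: "msubsts Ts (msubst 0 (lift_c_elim 0 e) M) = msubsts (e # Ts) M"
  by (auto intro!: sb_cong simp: msubst_sb sb_sb sb_ren lift_0 fun_eq_iff split: nat.split)

lemma sred_length: "sred Ts Ts' \<Longrightarrow> length Ts' \<le> length Ts"
  by (induct rule: sred.induct) auto

lemma sn_apps_Mu: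
  assumes "sn (msubsts Ts M)" "terminating sred Ts"
  shows "sn (apps (Mu M) Ts)"
proof -
  \<comment> \<open>Absorbing an eliminator preserves the first component and drops the head of
    \<open>Ts\<close>, which is not an \<open>sred\<close> step; so the length precedes
    \<open>Ts\<close>. A step in \<open>Ts\<close> may be lost in the first component but never
    increases the length.\<close>
  have "wf (descent red <*lex*> less_than <*lex*> descent sred)"
    by (intro wf_lex_prod wf_descent wf_less_than)
  then show ?thesis using assms
  proof (induct "(msubsts Ts M, length Ts, Ts)" arbitrary: M Ts rule: wf_induct_rule)
    case less
    note IH = less.hyps and sn = less.prems
    show ?case
    proof (rule terminatingI)
      fix X assume "red (apps (Mu M) Ts) X"
      then show "sn X"
      proof (cases rule: red_apps_cases)
        case (left P)
        then obtain M' where M': "P = Mu M'" "red M M'"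
          by (auto elim: red_MuE contract.cases)
        then have "red (msubsts Ts M) (msubsts Ts M')" by (simp add: red_sb)
        then show ?thesis unfolding left M'(1)
          using sn by (intro IH descent_lexI') (auto intro: terminating_step)
      next
        case (right Us)
        have "red\<^sup>*\<^sup>* (msubsts Ts M) (msubsts Us M)"
          by (rule sb_reds) (auto intro: right(1) sred_ren split: nat.split)
        moreover have "((length Us, Us), (length Ts, Ts)) \<in> less_than <*lex*> descent sred"
          using sred_length[OF right(1)] sn(2) right(1) by (auto intro: descent_step)
        ultimately show ?thesis unfolding right(2)
          using sn right(1) by (intro IH descent_lexI) (auto intro: terminating_step terminating_steps)
      next
        case (root e Us P)
        then have P: "P = Mu (msubst 0 (lift_c_elim 0 e) M)" by (auto elim: contractE)
        have "terminating sred Us"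
          by (rule terminating_map[of sred "(#) e"]) (use sn(2) root(1) in \<open>auto intro: sred_tail\<close>)
        then show ?thesis unfolding root(3) P
          using sn root(1) by (intro IH) (simp_all add: msubsts_Cons del: list.map)
      qed
    qed
  qed
qed

section \<open>Reducibility\<close>

text \<open>
  Quantifying over the renamings \<open>\<rho>\<close> makes the sets stable under \<open>ren id \<rho>\<close>, which is needed to
  go under a \<open>Mu\<close>. In the clause for \<open>Or\<close>, the eliminators following a \<open>Case\<close> are
  unrestricted: permutative conversions thus remain in the set.
\<close>

definition ortho :: "elim list set \<Rightarrow> trm set" where
  "ortho K = {M. \<forall>\<rho>. \<forall>Ts \<in> K. sn (apps (ren id \<rho> M) Ts)}"

primrec stacks :: "fm \<Rightarrow> elim list set" where
  "stacks (Atom n) = {[]}"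
| "stacks Bot = {[]}"
| "stacks (Imp A B) = insert [] {Tm N # Ts | N Ts. N \<in> ortho (stacks A) \<and> Ts \<in> stacks B}"
| "stacks (And A B) = insert [] ((#) Proj1 ` stacks A \<union> (#) Proj2 ` stacks B)"
| "stacks (Or A B) = insert [] {Case N1 N2 # Ts | N1 N2 Ts. \<forall>\<rho>.
     (\<forall>M \<in> ortho (stacks A). sn (apps (subst 0 M (ren id \<rho> N1)) (map (ren_elim id \<rho>) Ts))) \<and>
     (\<forall>M \<in> ortho (stacks B). sn (apps (subst 0 M (ren id \<rho> N2)) (map (ren_elim id \<rho>) Ts)))}"

text \<open>The empty sequence is put into every set so that reducible terms are themselves
  terminating, see \<open>ortho_sn\<close>.\<close>

lemma stacks_Nil: "[] \<in> stacks A"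
  by (cases A) auto

lemma ortho_sn_apps:
  assumes "M \<in> ortho K" "Ts \<in> K"
  shows "sn (apps M Ts)"
proof -
  have "sn (apps (ren id id M) Ts)" using assms unfolding ortho_def by blast
  then show ?thesis by simp
qed

lemma ortho_sn: "M \<in> ortho (stacks A) \<Longrightarrow> sn M"
  using ortho_sn_apps[OF _ stacks_Nil] by simp

lemma ren_id_comp:
  "ren id \<rho> (ren id \<rho>' M) = ren id (\<lambda>a. \<rho> (\<rho>' a)) M"
  "ren_elim id \<rho> (ren_elim id \<rho>' e) = ren_elim id (\<lambda>a. \<rho> (\<rho>' a)) e"
  by (simp_all add: ren_ren id_def)

lemma ortho_ren: "M \<in> ortho K \<Longrightarrow> ren id \<rho> M \<in> ortho K"
  by (simp add: ortho_def ren_id_comp)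

lemma stacks_ren: "Ts \<in> stacks A \<Longrightarrow> map (ren_elim id \<rho>) Ts \<in> stacks A"
proof (induct A arbitrary: Ts)
  case (Imp A B)
  then show ?case by (auto simp: ortho_def ren_id_comp[unfolded id_def] id_def)
next
  case (Or A B)
  have up_id: "up (\<lambda>i. i) = (\<lambda>i. i)" by (auto simp: fun_eq_iff split: nat.split)
  from Or.prems show ?case by (auto simp: ortho_def ren_id_comp[unfolded id_def] o_def id_def up_id)
qed auto

lemma ortho_IVar: "(\<And>Ts. Ts \<in> K \<Longrightarrow> terminating sred Ts) \<Longrightarrow> IVar i \<in> ortho K"
  by (auto simp: ortho_def intro: sn_apps_IVar)

text \<open>Each step survives the substitution, which also undoes the lifting of \<open>Ts\<close>.
  This leads from instantiated branches, as tested in \<open>stacks\<close>, to the open branches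
  that \<open>terminating_sred_Case\<close> speaks of.\<close>

lemma sn_subst_IVarD:
  assumes "sn (apps (subst 0 P M) Ts)"
  shows "sn (apps M (map (ren_elim Suc id) Ts))"
  by (rule terminating_map[of red "subst 0 P"]) (auto simp: subst_apps_lift assms red_subst)

text \<open>Termination of the sequences for \<open>A\<close> and \<open>B\<close> makes variables
  reducible at these types. For \<open>Or\<close> the branches can thus be instantiated by a
  variable, and termination of the open branches is recovered from that.\<close>

lemma stacks_terminating: "Ts \<in> stacks A \<Longrightarrow> terminating sred Ts"
proof (induct A arbitrary: Ts)
  case (Imp A B)
  show ?case
  proof (cases "Ts = []")
    case False
    with Imp.prems obtain N Us where "Ts = Tm N # Us" "N \<in> ortho (stacks A)" "Us \<in> stacks B"
      by auto
    then show ?thesis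
      using Imp.hyps(2) by (simp only:) (intro terminating_sred_Cons sn_Tm ortho_sn[of N A], auto)
  qed (simp add: terminating_sred_Nil)
next
  case (And A B)
  have "terminating red_elim Proj1" "terminating red_elim Proj2"
    by (rule terminatingI, erule red_elim_Proj1E red_elim_Proj2E)+
  with And show ?case by (auto intro!: terminating_sred_Nil terminating_sred_Cons)
next
  case (Or A B)
  show ?case
  proof (cases "Ts = []")
    case False
    with Or.prems obtain N1 N2 Us where Ts: "Ts = Case N1 N2 # Us"
      and *: "\<And>\<rho> M. M \<in> ortho (stacks A) \<Longrightarrow>
        sn (apps (subst 0 M (ren id \<rho> N1)) (map (ren_elim id \<rho>) Us))"
        "\<And>\<rho> M. M \<in> ortho (stacks B) \<Longrightarrow>
        sn (apps (subst 0 M (ren id \<rho> N2)) (map (ren_elim id \<rho>) Us))"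
      by auto
    have "sn (apps N1 (map (ren_elim Suc id) Us))"
      using *(1)[OF ortho_IVar[OF Or.hyps(1)], where \<rho> = id]
      by (intro sn_subst_IVarD[of "IVar 0"]) simp
    moreover have "sn (apps N2 (map (ren_elim Suc id) Us))"
      using *(2)[OF ortho_IVar[OF Or.hyps(2)], where \<rho> = id]
      by (intro sn_subst_IVarD[of "IVar 0"]) simp
    ultimately show ?thesis unfolding Ts by (rule terminating_sred_Case)
  qed (simp add: terminating_sred_Nil)
qed (auto intro: terminating_sred_Nil)

section \<open>Adequacy of the interpretation\<close>

definition adequate :: "fm list \<Rightarrow> fm list \<Rightarrow> (nat \<Rightarrow> trm) \<Rightarrow> (nat \<Rightarrow> elim list) \<Rightarrow> bool" where
  "adequate \<Gamma> \<Delta> \<sigma> \<kappa> \<longleftrightarrow> (\<forall>i < length \<Gamma>. \<sigma> i \<in> ortho (stacks (\<Gamma> ! i))) \<and>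
     (\<forall>a < length \<Delta>. \<kappa> a \<in> stacks (\<Delta> ! a))"

lemma adequate_ren:
  assumes "adequate \<Gamma> \<Delta> \<sigma> \<kappa>"
  shows "adequate \<Gamma> \<Delta> (\<lambda>i. ren id \<rho> (\<sigma> i)) (\<lambda>a. map (ren_elim id \<rho>) (\<kappa> a))"
  using assms ortho_ren stacks_ren unfolding adequate_def by blast

lemma adequate_Cons_i:
  assumes "adequate \<Gamma> \<Delta> \<sigma> \<kappa>" "N \<in> ortho (stacks A)"
  shows "adequate (A # \<Gamma>) \<Delta> (case_nat N \<sigma>) \<kappa>"
  using assms unfolding adequate_def by (auto simp: nth_Cons split: nat.split)

lemma adequate_Cons_c:
  assumes "adequate \<Gamma> \<Delta> \<sigma> \<kappa>" "Ts \<in> stacks A"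
  shows "adequate \<Gamma> (A # \<Delta>) \<sigma> (case_nat Ts \<kappa>)"
  using assms unfolding adequate_def by (auto simp: nth_Cons split: nat.split)

text \<open>Renaming a substitution instance gives another adequate instance, with another
  \<open>\<zeta>\<close>; leaving \<open>\<zeta>\<close> arbitrary thus absorbs the quantifier over
  renamings in \<open>ortho\<close>.\<close>

lemma sb_orthoI:
  assumes "\<And>\<sigma> \<zeta> \<kappa> Ts. adequate \<Gamma> \<Delta> \<sigma> \<kappa> \<Longrightarrow> Ts \<in> stacks A \<Longrightarrow> sn (apps (sb \<sigma> \<zeta> \<kappa> M) Ts)"
    and "adequate \<Gamma> \<Delta> \<sigma> \<kappa>"
  shows "sb \<sigma> \<zeta> \<kappa> M \<in> ortho (stacks A)"
  using assms(1)[OF adequate_ren[OF assms(2)]] by (simp add: ortho_def ren_sb)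

lemma subst_sb_up:
  "subst 0 N (sb (up_i \<sigma>) \<zeta> (\<lambda>a. map (ren_elim Suc id) (\<kappa> a)) M) = sb (case_nat N \<sigma>) \<zeta> \<kappa> M"
  by (auto intro!: sb_cong simp: subst_sb sb_sb sb_ren fun_eq_iff o_def simp flip: id_def split: nat.split)

lemma ren_sb_up:
  "ren id \<rho> (sb (up_i \<sigma>) \<zeta> (\<lambda>a. map (ren_elim Suc id) (\<kappa> a)) M) =
     sb (up_i (\<lambda>i. ren id \<rho> (\<sigma> i))) (\<lambda>a. \<rho> (\<zeta> a))
       (\<lambda>a. map (ren_elim Suc id) (map (ren_elim id \<rho>) (\<kappa> a))) M"
  unfolding ren_sb by (intro sb_cong) (auto simp: fun_eq_iff ren_ren split: nat.split)

lemma msubsts_sb_up: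
  "msubsts Ts (sb (\<lambda>i. ren id Suc (\<sigma> i)) (up \<zeta>) (up_c \<kappa>) M) =
     sb (\<lambda>i. ren id Suc (\<sigma> i)) (up \<zeta>)
       (case_nat (map (ren_elim id Suc) Ts) (\<lambda>a. map (ren_elim id Suc) (\<kappa> a))) M"
  by (auto intro!: sb_cong simp: sb_sb sb_ren fun_eq_iff split: nat.split)

lemma ortho_IVar_stacks: "IVar i \<in> ortho (stacks A)"
  by (rule ortho_IVar) (rule stacks_terminating)

lemma sn_substD:
  assumes "sn (subst 0 P M)"
  shows "sn M"
  by (rule terminating_map[of red "subst 0 P"]) (auto intro: assms red_subst)

text \<open>Elimination rules push their eliminator onto \<open>Ts\<close>; introduction rules
  inspect \<open>Ts\<close> and use head expansion. A classical variable declared with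
  \<open>A\<close> stands for a sequence in \<open>stacks A\<close>, so \<open>Mu\<close> stores the
  current sequence and \<open>CApp\<close> restores it, as with continuations.\<close>

lemma sn_apps_sb:
  "typing \<Gamma> \<Delta> M A \<Longrightarrow> adequate \<Gamma> \<Delta> \<sigma> \<kappa> \<Longrightarrow> Ts \<in> stacks A \<Longrightarrow> sn (apps (sb \<sigma> \<zeta> \<kappa> M) Ts)"
proof (induct arbitrary: \<sigma> \<zeta> \<kappa> Ts rule: typing.induct)
  case (T_IVar i \<Gamma> \<Delta>)
  then show ?case using ortho_sn_apps[of "\<sigma> i"] unfolding adequate_def by auto
next
  case (T_Pair \<Gamma> \<Delta> M A N B)
  note M = T_Pair.hyps(2)[OF T_Pair.prems(1)] and N = T_Pair.hyps(4)[OF T_Pair.prems(1)]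
  note sn = M[OF stacks_Nil, simplified] N[OF stacks_Nil, simplified]
  from T_Pair.prems(2) consider "Ts = []" | Us where "Ts = Proj1 # Us" "Us \<in> stacks A"
    | Us where "Ts = Proj2 # Us" "Us \<in> stacks B"
    by auto
  then show ?case
  proof cases
    case 1
    then show ?thesis using sn by (simp add: sn_Pair)
  next
    case 2
    then show ?thesis unfolding 2(1) sb.simps by (intro sn_apps_Proj1 M sn)
  next
    case 3
    then show ?thesis unfolding 3(1) sb.simps by (intro sn_apps_Proj2 N sn)
  qed
next
  case (T_Proj1 \<Gamma> \<Delta> M A B)
  then have "Proj1 # Ts \<in> stacks (And A B)" by simp
  from T_Proj1.hyps(2)[OF T_Proj1.prems(1) this] show ?case by simp
next
  case (T_Proj2 \<Gamma> \<Delta> M A B)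
  then have "Proj2 # Ts \<in> stacks (And A B)" by simp
  from T_Proj2.hyps(2)[OF T_Proj2.prems(1) this] show ?case by simp
next
  case (T_Lam A \<Gamma> \<Delta> M B)
  let ?M = "sb (up_i \<sigma>) \<zeta> (\<lambda>a. map (ren_elim Suc id) (\<kappa> a)) M"
  have M: "sn (apps (subst 0 N ?M) Us)" if "N \<in> ortho (stacks A)" "Us \<in> stacks B" for N Us
    unfolding subst_sb_up by (rule T_Lam.hyps(2)[OF adequate_Cons_i[OF T_Lam.prems(1) that(1)] that(2)])
  from T_Lam.prems(2) consider "Ts = []"
    | N Us where "Ts = Tm N # Us" "N \<in> ortho (stacks A)" "Us \<in> stacks B"
    by auto
  then show ?case
  proof cases
    case 1
    \<comment> \<open>Variables are reducible, so the open body is reached from its instance by a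
      variable.\<close>
    have "sn ?M" using M[OF ortho_IVar_stacks stacks_Nil] by (auto intro: sn_substD)
    then show ?thesis using 1 by (simp add: sn_Lam)
  next
    case 2
    then show ?thesis unfolding 2(1) sb.simps by (intro sn_apps_Lam M ortho_sn[OF 2(2)])
  qed
next
  case (T_App \<Gamma> \<Delta> M A B N)
  have "sb \<sigma> \<zeta> \<kappa> N \<in> ortho (stacks A)"
    by (rule sb_orthoI[OF T_App.hyps(4) T_App.prems(1)])
  then have "Tm (sb \<sigma> \<zeta> \<kappa> N) # Ts \<in> stacks (Imp A B)" using T_App.prems(2) by simp
  from T_App.hyps(2)[OF T_App.prems(1) this] show ?case by simp
next
  case (T_Inj1 \<Gamma> \<Delta> M A B)
  have M: "sb \<sigma> \<zeta> \<kappa> M \<in> ortho (stacks A)"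
    by (rule sb_orthoI[OF T_Inj1.hyps(2) T_Inj1.prems(1)])
  show ?case
  proof (cases "Ts = []")
    case True
    then show ?thesis using ortho_sn[OF M] by (simp add: sn_Inj1)
  next
    case False
    with T_Inj1.prems(2) obtain N1 N2 Us where Ts: "Ts = Case N1 N2 # Us"
      and *: "\<And>\<rho> M. M \<in> ortho (stacks A) \<Longrightarrow>
        sn (apps (subst 0 M (ren id \<rho> N1)) (map (ren_elim id \<rho>) Us))"
        "\<And>\<rho> M. M \<in> ortho (stacks B) \<Longrightarrow>
        sn (apps (subst 0 M (ren id \<rho> N2)) (map (ren_elim id \<rho>) Us))"
      by auto
    show ?thesis unfolding Ts sb.simps
      using *(1)[OF M, of id] *(2)[OF ortho_IVar_stacks[of 0], of id]
      by (intro sn_apps_Inj1 ortho_sn[OF M] sn_subst_IVarD[of "IVar 0"]) simp_all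
  qed
next
  case (T_Inj2 \<Gamma> \<Delta> M B A)
  have M: "sb \<sigma> \<zeta> \<kappa> M \<in> ortho (stacks B)"
    by (rule sb_orthoI[OF T_Inj2.hyps(2) T_Inj2.prems(1)])
  show ?case
  proof (cases "Ts = []")
    case True
    then show ?thesis using ortho_sn[OF M] by (simp add: sn_Inj2)
  next
    case False
    with T_Inj2.prems(2) obtain N1 N2 Us where Ts: "Ts = Case N1 N2 # Us"
      and *: "\<And>\<rho> M. M \<in> ortho (stacks A) \<Longrightarrow>
        sn (apps (subst 0 M (ren id \<rho> N1)) (map (ren_elim id \<rho>) Us))"
        "\<And>\<rho> M. M \<in> ortho (stacks B) \<Longrightarrow>
        sn (apps (subst 0 M (ren id \<rho> N2)) (map (ren_elim id \<rho>) Us))"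
      by auto
    show ?thesis unfolding Ts sb.simps
      using *(2)[OF M, of id] *(1)[OF ortho_IVar_stacks[of 0], of id]
      by (intro sn_apps_Inj2 ortho_sn[OF M] sn_subst_IVarD[of "IVar 0"]) simp_all
  qed
next
  case (T_Case \<Gamma> \<Delta> M A B N1 C N2)
  \<comment> \<open>\<open>Ts\<close> belongs to \<open>C\<close>, which is unrelated to
    \<open>Or A B\<close>; it may follow the \<open>Case\<close> because the clause for
    \<open>Or\<close> only tests instantiated branches in front of \<open>Ts\<close>, and these are
    covered by the induction hypotheses for the branches.\<close>
  have "sn (apps (subst 0 P (ren id \<rho> (sb (up_i \<sigma>) \<zeta> (\<lambda>a. map (ren_elim Suc id) (\<kappa> a)) N1)))
      (map (ren_elim id \<rho>) Ts))" if "P \<in> ortho (stacks A)" for P \<rho>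
    unfolding ren_sb_up subst_sb_up
    by (rule T_Case.hyps(4)[OF adequate_Cons_i[OF adequate_ren[OF T_Case.prems(1)] that]
          stacks_ren[OF T_Case.prems(2)]])
  moreover have "sn (apps (subst 0 P (ren id \<rho> (sb (up_i \<sigma>) \<zeta> (\<lambda>a. map (ren_elim Suc id) (\<kappa> a)) N2)))
      (map (ren_elim id \<rho>) Ts))" if "P \<in> ortho (stacks B)" for P \<rho>
    unfolding ren_sb_up subst_sb_up
    by (rule T_Case.hyps(6)[OF adequate_Cons_i[OF adequate_ren[OF T_Case.prems(1)] that]
          stacks_ren[OF T_Case.prems(2)]])
  ultimately have "sb_elim \<sigma> \<zeta> \<kappa> (Case N1 N2) # Ts \<in> stacks (Or A B)"
    unfolding stacks.simps sb_elim.simps by blast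
  from T_Case.hyps(2)[OF T_Case.prems(1) this] show ?case by simp
next
  case (T_Mu \<Gamma> A \<Delta> M)
  \<comment> \<open>The variable bound by \<open>Mu\<close> receives the current \<open>Ts\<close>;
    the body, of type \<open>Bot\<close>, is then taken with the empty sequence.\<close>
  have "adequate \<Gamma> (A # \<Delta>) (\<lambda>i. ren id Suc (\<sigma> i))
      (case_nat (map (ren_elim id Suc) Ts) (\<lambda>a. map (ren_elim id Suc) (\<kappa> a)))"
    by (intro adequate_Cons_c adequate_ren stacks_ren T_Mu.prems)
  from T_Mu.hyps(2)[OF this stacks_Nil, of "up \<zeta>"]
  show ?case unfolding sb.simps
    by (intro sn_apps_Mu stacks_terminating[OF T_Mu.prems(2)]) (simp add: msubsts_sb_up)
next
  case (T_CApp a \<Delta> \<Gamma> M)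
  have "\<kappa> a \<in> stacks (\<Delta> ! a)" using T_CApp.prems(1) T_CApp.hyps(1) unfolding adequate_def by blast
  from T_CApp.hyps(3)[OF T_CApp.prems(1) this]
  show ?case using T_CApp.prems(2) by (simp add: sn_CApp)
qed

theorem typing_sn:
  assumes "typing \<Gamma> \<Delta> M A"
  shows "sn M"
proof -
  have "adequate \<Gamma> \<Delta> IVar (\<lambda>_. [])"
    using ortho_IVar_stacks stacks_Nil unfolding adequate_def by blast
  from sn_apps_sb[OF assms this stacks_Nil, of id] show ?thesis by simp
qed

section \<open>From termination to \<open>SN\<close>, for terms and their arguments\<close>

lemma terminating_SN: "terminating red_elim e \<Longrightarrow> e \<in> SN"
proof (induct rule: terminating.induct)
  case (terminatingI e)
  have False if f: "f 0 = e" "\<And>i. red_elim (f i) (f (Suc i))" for f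
  proof -
    have "f 1 \<in> SN" using terminatingI(2)[of "f 1"] f(1) f(2)[of 0] by simp
    moreover have "f 1 \<notin> SN" unfolding SN_def
      using f(2) by (auto intro!: exI[of _ "\<lambda>i. f (Suc i)"])
    ultimately show False by simp
  qed
  then show ?case unfolding SN_def by blast
qed

lemmas terminating_parts =
  terminating_map[of red "\<lambda>M. App M e" _ red for e, OF _ red_red_elim.intros(3)]
  terminating_map[of red "App M" _ red_elim for M, OF _ red_red_elim.intros(4)]
  terminating_map[of red "\<lambda>M. Pair M N" _ red for N, OF _ red_red_elim.intros(5)]
  terminating_map[of red "Pair M" _ red for M, OF _ red_red_elim.intros(6)]
  terminating_map[of red Inj1 _ red, OF _ red_red_elim.intros(7)]
  terminating_map[of red Inj2 _ red, OF _ red_red_elim.intros(8)]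
  terminating_map[of red "CApp a" _ red for a, OF _ red_red_elim.intros(10)]
  terminating_map[of red_elim Tm _ red, OF _ red_red_elim.intros(11)]
  terminating_map[of red_elim "\<lambda>M. Case M N" _ red for N, OF _ red_red_elim.intros(12)]
  terminating_map[of red_elim "Case M" _ red for M, OF _ red_red_elim.intros(13)]

lemma sn_apps_parts: "sn (apps M Ts) \<Longrightarrow> sn M \<and> (\<forall>e \<in> set Ts. terminating red_elim e)"
  by (induct Ts arbitrary: M) (auto dest: terminating_parts)

lemma head_form_args_SN: "head_form M h S Ts \<Longrightarrow> sn M \<Longrightarrow> S \<subseteq> SN"
  by (induct rule: head_form.induct)
    (auto 0 3 intro!: terminating_SN sn_Tm dest!: sn_apps_parts dest: terminating_parts)

section \<open>Heads\<close>

lemma head_form_contract: "head_form M (Redex R) S Ts \<Longrightarrow> \<exists>R'. contract R R' \<and> red M (apps R' Ts)"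
proof -
  assume M: "head_form M (Redex R) S Ts"
  then have "M = apps R Ts" by (cases rule: head_form.cases) auto
  moreover from M obtain R' where "contract R R'"
    by (cases rule: head_form.cases) (auto intro: contract.intros)
  ultimately show ?thesis using red_apps_left[OF red_red_elim.intros(1)] by blast
qed

lemma contract_unique: "contract R M \<Longrightarrow> contract R N \<Longrightarrow> M = N"
  by (induct rule: contract.induct) (auto elim: contract.cases)

fun spine :: "trm \<Rightarrow> trm \<times> elim list" where
  "spine (App M e) = (fst (spine M), snd (spine M) @ [e])"
| "spine M = (M, [])"

lemma spine_apps: "spine (apps M Ts) = (fst (spine M), snd (spine M) @ Ts)"
  by (induct Ts arbitrary: M) auto

lemma apps_spine: "apps (fst (spine M)) (snd (spine M)) = M"
  by (induct M rule: spine.induct) auto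

lemma nice_Nil: "nice []"
  by (simp add: nice_def)

lemma nice_Cons: "nice (e # Ts) \<longleftrightarrow> nice Ts \<and> (Ts = [] \<or> (\<forall>N1 N2. e \<noteq> Case N1 N2))"
  by (auto simp: nice_def)

lemma not_nice_append: "\<not> nice (Us @ Case N1 N2 # e # Ts)"
  by (induct Us) (auto simp: nice_Cons)

text \<open>The \<open>Case\<close> to choose is the last one that is not final: what follows it is
  then nice.\<close>

lemma not_nice_split:
  "\<not> nice Ts \<Longrightarrow> \<exists>Us N1 N2 e Vs. Ts = Us @ Case N1 N2 # e # Vs \<and> nice (e # Vs)"
proof (induct Ts)
  case Nil
  then show ?case by (simp add: nice_def)
next
  case (Cons e Ts)
  show ?case
  proof (cases "nice Ts")
    case True
    with Cons.prems obtain N1 N2 where "e = Case N1 N2" "Ts \<noteq> []" by (auto simp: nice_Cons)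
    then show ?thesis using True by (cases Ts) (auto intro!: exI[of _ "[]"])
  next
    case False
    with Cons.hyps obtain Us N1 N2 f Vs where "Ts = Us @ Case N1 N2 # f # Vs" "nice (f # Vs)"
      by blast
    then show ?thesis by (auto intro!: exI[of _ "e # Us"])
  qed
qed

text \<open>If one splitting were further left, its nice remainder would contain the
  \<open>Case\<close> of the other before its end, against \<open>not_nice_append\<close>.\<close>

lemma not_nice_unique:
  assumes "Us @ Case N1 N2 # e # Ts = Us' @ Case N1' N2' # e' # Ts'" "nice (e # Ts)" "nice (e' # Ts')"
  shows "Us = Us' \<and> N1 = N1' \<and> N2 = N2' \<and> e = e' \<and> Ts = Ts'"
  using assms(1)
proof (induct Us arbitrary: Us')
  case Nil
  then show ?case using assms(2) not_nice_append
    by (cases Us') auto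
next
  case (Cons f Us)
  then show ?case using assms(3) not_nice_append[of Us]
    by (cases Us') (auto, metis)
qed

text \<open>
  If the sequence \<open>L\<close> of all eliminators on the spine is nice, then the head is at the base \<open>B\<close>;
  otherwise it is the permutative redex at the last \<open>Case\<close> of \<open>L\<close> that is not final.
\<close>

lemma head_form_spine:
  assumes "head_form M h S Ts" "spine M = (B, L)"
  shows "nice L \<and> (case B of
      IVar i \<Rightarrow> h = IVarHead i \<and> S = set L \<and> Ts = L
    | CApp a T \<Rightarrow> L = [] \<and> h = CVarHead a \<and> S = {Tm T} \<and> Ts = [Tm T]
    | Lam N \<Rightarrow> (\<exists>P. L = Tm P # Ts \<and> h = Redex (App B (Tm P)) \<and> S = {Tm P})
    | Pair N1 N2 \<Rightarrow> (\<exists>p. L = p # Ts \<and> h = Redex (App B p) \<and> S = {Tm N1, Tm N2})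
    | Inj1 N \<Rightarrow> (\<exists>N1 N2. L = [Case N1 N2] \<and> Ts = [] \<and> h = Redex M \<and> S = {Tm N, Tm N1, Tm N2})
    | Inj2 N \<Rightarrow> (\<exists>N1 N2. L = [Case N1 N2] \<and> Ts = [] \<and> h = Redex M \<and> S = {Tm N, Tm N1, Tm N2})
    | Mu N \<Rightarrow> (\<exists>e. L = e # Ts \<and> h = Redex (App B e) \<and> S = {e})
    | App _ _ \<Rightarrow> False) \<or>
    (\<exists>Us N1 N2 e. L = Us @ Case N1 N2 # e # Ts \<and> nice (e # Ts) \<and>
      h = Redex (App (App (apps B Us) (Case N1 N2)) e) \<and> S = {})"
  using assms
proof (cases rule: head_form.cases)
  case (H_Case R N N1 N2 e)
  obtain B' Us where N: "spine N = (B', Us)" by (cases "spine N")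
  then have "N = apps B' Us" using apps_spine[of N] by simp
  with H_Case N assms(2) show ?thesis by (intro disjI2) (auto simp: spine_apps)
next
  case H_Inj
  with assms(2) show ?thesis by (auto simp: nice_def)
qed (use assms(2) in \<open>intro disjI1, auto simp: spine_apps nice_Nil nice_Cons\<close>)

text \<open>Justifies the descriptions in \<open>arg\<close> and \<open>hred\<close>: whether the
  spine is nice decides which alternative of \<open>head_form_spine\<close> applies, and within it
  all data are determined by the spine.\<close>

lemma head_form_unique:
  assumes "head_form M h S Ts" "head_form M h' S' Ts'"
  shows "h = h' \<and> S = S' \<and> Ts = Ts'"
proof -
  obtain B L where BL: "spine M = (B, L)" by (cases "spine M")
  show ?thesis
  proof (cases "nice L")
    case True
    then have "L \<noteq> Us @ Case N1 N2 # e # Vs" for Us N1 N2 e Vs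
      using not_nice_append by blast
    then show ?thesis
      using head_form_spine[OF assms(1) BL] head_form_spine[OF assms(2) BL]
      by (cases B) auto
  next
    case False
    then obtain Us N1 N2 e Us' N1' N2' e'
      where "L = Us @ Case N1 N2 # e # Ts" "nice (e # Ts)" "S = {}"
        "h = Redex (App (App (apps B Us) (Case N1 N2)) e)"
        "L = Us' @ Case N1' N2' # e' # Ts'" "nice (e' # Ts')" "S' = {}"
        "h' = Redex (App (App (apps B Us') (Case N1' N2')) e')"
      using head_form_spine[OF assms(1) BL] head_form_spine[OF assms(2) BL] by blast
    then show ?thesis using not_nice_unique[of Us N1 N2 e Ts Us' N1' N2' e' Ts'] by simp
  qed
qed

inductive_cases typing_AppE: "typing \<Gamma> \<Delta> (App M e) A"

text \<open>Typing excludes the stuck combinations, which have no head form. \<open>CApp\<close> has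
  type \<open>Bot\<close>, which no eliminator accepts.\<close>

lemma typed_App_cases:
  "typed (App (Lam N) e) \<Longrightarrow> \<exists>P. e = Tm P"
  "typed (App (Pair N1 N2) e) \<Longrightarrow> e = Proj1 \<or> e = Proj2"
  "typed (App (Inj1 N) e) \<Longrightarrow> \<exists>N1 N2. e = Case N1 N2"
  "typed (App (Inj2 N) e) \<Longrightarrow> \<exists>N1 N2. e = Case N1 N2"
  "\<not> typed (App (CApp a N) e)"
  by (auto simp: typed_def elim!: typing_AppE elim: typing.cases)

lemma typed_App: "typed (App M e) \<Longrightarrow> typed M"
  unfolding typed_def by (blast elim: typing_AppE)

lemma typed_apps: "typed (apps M Ts) \<Longrightarrow> typed M"
  by (induct Ts arbitrary: M) (auto dest: typed_App)

lemma spine_not_App: "fst (spine M) \<noteq> App N e"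
  by (induct M rule: spine.induct) auto

lemma head_form_exists:
  assumes "simple M" "typed M"
  shows "\<exists>h S Ts. head_form M h S Ts"
proof -
  obtain B L where BL: "spine M = (B, L)" by (cases "spine M")
  then have M: "M = apps B L" and B: "\<And>N e. B \<noteq> App N e"
    using apps_spine[of M] spine_not_App[of M] by auto
  show ?thesis
  proof (cases "nice L")
    case False
    then obtain Us N1 N2 e Ts where L: "L = Us @ Case N1 N2 # e # Ts" "nice (e # Ts)"
      using not_nice_split by blast
    show ?thesis using H_Case[OF refl L(2), of "apps B Us" N1 N2] by (auto simp: M L(1))
  next
    case nice: True
    show ?thesis
    proof (cases L)
      case Nil
      then show ?thesis
        using assms(1) B M H_IVar[of "[]"] H_CApp by (fastforce simp: simple_def nice_def)
    next
      case (Cons e Ts)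
      have typed: "typed (App B e)" using assms(2) typed_apps[of "App B e" Ts] by (simp add: M Cons)
      have Ts: "nice Ts" using nice by (simp add: Cons nice_Cons)
      show ?thesis
      proof (cases B)
        case (IVar i)
        then show ?thesis using H_IVar[OF nice, of i] M by blast
      next
        case (Lam N)
        then obtain P where "e = Tm P" using typed typed_App_cases(1) by blast
        then show ?thesis using H_Lam[OF refl Ts, of N P] by (auto simp: M Cons Lam)
      next
        case (Pair N1 N2)
        then have "e = Proj1 \<or> e = Proj2" using typed typed_App_cases(2) by blast
        then show ?thesis using H_Pair[OF refl _ Ts, of e N1 N2] by (auto simp: M Cons Pair)
      next
        case (Inj1 N)
        then obtain N1 N2 where e: "e = Case N1 N2" using typed typed_App_cases(3) by blast
        with nice have "Ts = []" by (simp add: Cons nice_Cons)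
        then show ?thesis using H_Inj[OF refl, of "Inj1 N" N N1 N2] by (auto simp: M Cons Inj1 e)
      next
        case (Inj2 N)
        then obtain N1 N2 where e: "e = Case N1 N2" using typed typed_App_cases(4) by blast
        with nice have "Ts = []" by (simp add: Cons nice_Cons)
        then show ?thesis using H_Inj[OF refl, of "Inj2 N" N N1 N2] by (auto simp: M Cons Inj2 e)
      next
        case (Mu N)
        then show ?thesis using H_Mu[OF refl nice[unfolded Cons], of N] by (auto simp: M Cons)
      next
        case (CApp a N)
        then show ?thesis using typed typed_App_cases(5) by blast
      qed (use B in auto)
    qed
  qed
qed

lemma arg_eq: "head_form M h S Ts \<Longrightarrow> arg M = S"
  unfolding arg_def by (rule the_equality) (auto dest: head_form_unique)

lemma hred_eq:
  assumes "head_form M (Redex R) S Ts" "contract R R'"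
  shows "hred M = apps R' Ts"
  unfolding hred_def
  using assms by (intro the_equality) (auto dest: head_form_unique contract_unique)

theorem theorem3p6:
  fixes M :: trm
  assumes "simple M" and "typed M"
  shows "(has_head_redex M \<longrightarrow> (Tm M \<in> SN \<longleftrightarrow> arg M \<subseteq> SN \<and> Tm (hred M) \<in> SN)) \<and>
         (\<not> has_head_redex M \<longrightarrow> (Tm M \<in> SN \<longleftrightarrow> arg M \<subseteq> SN))"
proof -
  have sn: "sn M" using assms(2) typing_sn unfolding typed_def by blast
  then have "Tm M \<in> SN" by (intro terminating_SN sn_Tm)
  moreover obtain h S Ts where "head_form M h S Ts" using head_form_exists[OF assms] by blast
  then have "arg M \<subseteq> SN" using head_form_args_SN sn arg_eq by blast
  moreover have "Tm (hred M) \<in> SN" if redex: "has_head_redex M"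
  proof -
    from redex obtain R S Ts where H: "head_form M (Redex R) S Ts"
      unfolding has_head_redex_def by blast
    \<comment> \<open>The head reduct is a one-step reduct of \<open>M\<close>.\<close>
    then obtain R' where "contract R R'" "red M (apps R' Ts)" using head_form_contract by blast
    then show ?thesis using hred_eq[OF H] sn by (auto intro: terminating_SN sn_Tm terminating_step)
  qed
  ultimately show ?thesis by blast
qed

end
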